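(* Assume $f$ is $C^2$, each $g_i$ is a non-constant $C^2$ function, and the bounded measurable functions $w_i$ satisfy, for every $i=1,\dots,m$, \[ \int_{t_k}^{t_{k+1}}\big(v_i(t)-w_i(t)\big)\,dt=0,\qquad \int_{t_k}^{t_{k+1}}(t-t_{k+1/2})\big(v_i(t)-w_i(t)\big)\,dt=0. \] Then the local error is $O(h_k^2)$. Moreover, if each $w_i$ is affine (the unique affine function satisfying these two conditions), then with $E=\frac{e^{\Lambda h_k}-1}{\Lambda h_k}$, \[ \Big(1-\frac{Lh_k}{2}-h_kL'\Big)\|x(t_{k+1})-y(t_{k+1})\|\le\frac{h_k^2}{4}L'\Big(11K+\tfrac{69}{2}K'\Big)+\frac{7h_k^3}{8}K'\Big((4H'+H)\big(K+\tfrac52K'\big)+L^2+\big(\tfrac92L+5L'\big)L'\Big)E+\frac{7h_k^3}{48}(HK'+LL')(K+K'). \]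
   Context: Setting: for $m\ge 1$ consider on $\mathbb{R}^n$ the input-affine system $\dot x(t)=f(x(t))+\sum_{i=1}^m g_i(x(t))v_i(t)$, where $f,g_i:\mathbb{R}^n\to\mathbb{R}^n$ and each $v_i$ is a Lebesgue measurable function with $|v_i(t)|\le V_i$ for some $V_i>0$. Fix a time step $[t_k,t_{k+1}]$ with $h_k=t_{k+1}-t_k>0$ and $t_{k+1/2}=(t_k+t_{k+1})/2$, and let $x$ be a solution on $[t_k,t_{k+1}]$. Given real-valued bounded measurable functions $w_i$ on $[t_k,t_{k+1}]$, let $y$ be the solution of the approximate system $\dot y(t)=f(y(t))+\sum_{i=1}^m g_i(y(t))w_i(t)$ with $y(t_k)=x(t_k)$. Norms: $\|x\|=\max_j|x_j|$ on $\mathbb{R}^n$, the induced matrix norm $\|Q\|=\max_k\sum_i|q_{ki}|$, and the logarithmic norm $\lambda(Q)=\max_k\big(q_{kk}+\sum_{i\neq k}|q_{ki}|\big)$. Standing bounds: there is a convex set $B$ containing $x(t)$ and $y(t)$ for all $t\in[t_k,t_{k+1}]$ on which $\|f\|\le K$, $\|g_i\|\le K_i$, $\|Df\|\le L$, $\|Dg_i\|\le L_i$, $\|D^2f\|\le H$, $\|D^2g_i\|\le H_i$ (whenever these derivatives exist; $D$ is the Jacobian, $D^2$ the second derivative) and $\lambda(Df)\le\Lambda$, with $\Lambda\neq 0$. Put $K'=\sum_{i=1}^m V_iK_i$, $L'=\sum_{i=1}^m V_iL_i$, $H'=\sum_{i=1}^m V_iH_i$. *)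

theory Defs
  imports "HOL-Analysis.Analysis"
begin

definition mnorm :: "real^'n \<Rightarrow> real" where
  "mnorm x = (MAX j\<in>UNIV. \<bar>x $ j\<bar>)"

definition mat_norm :: "real^'n^'n \<Rightarrow> real" where
  "mat_norm Q = (MAX k\<in>UNIV. (\<Sum>i\<in>UNIV. \<bar>Q $ k $ i\<bar>))"

definition log_norm :: "real^'n^'n \<Rightarrow> real" where
  "log_norm Q = (MAX k\<in>UNIV. Q $ k $ k + (\<Sum>i\<in>UNIV - {k}. \<bar>Q $ k $ i\<bar>))"

definition Jac :: "(real^'n \<Rightarrow> real^'n) \<Rightarrow> real^'n \<Rightarrow> real^'n^'n" where
  "Jac f x = matrix (frechet_derivative f (at x))"

definition D2 :: "(real^'n \<Rightarrow> real^'n) \<Rightarrow> real^'n \<Rightarrow> real^'n \<Rightarrow> real^'n \<Rightarrow> real^'n" where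
  "D2 f x u v = frechet_derivative (Jac f) (at x) u *v v"

definition d2_norm :: "(real^'n \<Rightarrow> real^'n) \<Rightarrow> real^'n \<Rightarrow> real" where
  "d2_norm f x = (SUP uv\<in>{(u,v). mnorm u \<le> 1 \<and> mnorm v \<le> 1}. mnorm (D2 f x (fst uv) (snd uv)))"

definition C2 :: "(real^'n \<Rightarrow> real^'n) \<Rightarrow> bool" where
  "C2 f \<longleftrightarrow> (\<forall>x. f differentiable (at x)) \<and> (\<forall>x. Jac f differentiable (at x)) \<and>
     (\<forall>u. continuous_on UNIV (\<lambda>x. frechet_derivative (Jac f) (at x) u))"

text \<open>(Caratheodory) solution on [a,b] of z' = f z + sum_i u_i(t) g_i z, in integral form.\<close>
definition is_sol :: "(real^'n \<Rightarrow> real^'n) \<Rightarrow> (nat \<Rightarrow> real^'n \<Rightarrow> real^'n) \<Rightarrow> nat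
     \<Rightarrow> (nat \<Rightarrow> real \<Rightarrow> real) \<Rightarrow> real \<Rightarrow> real \<Rightarrow> (real \<Rightarrow> real^'n) \<Rightarrow> bool" where
  "is_sol f g m u a b z \<longleftrightarrow> (\<forall>t\<in>{a..b}.
     ((\<lambda>s. f (z s) + (\<Sum>i\<in>{1..m}. u i s *\<^sub>R g i (z s))) has_integral (z t - z a)) {a..t})"

end

theory Submission
  imports Defs
begin

text \<open>
  Write \<open>e = x - y\<close>, \<open>d\<^sub>i = v\<^sub>i - w\<^sub>i\<close> and let \<open>c\<close> be the midpoint of the step \<open>[a, b]\<close> of length \<open>h\<close>. Then
  \[ e(b) = \int (f(x) - f(y)) + \sum_i \int d_i\, g_i(x) + \sum_i \int w_i\, (g_i(x) - g_i(y)). \]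
  Since \<open>d\<^sub>i\<close> has mean zero, \<open>g\<^sub>i(x(t))\<close> may be replaced by \<open>g\<^sub>i(x(t)) - g\<^sub>i(x(c))\<close>, which is \<open>O(h)\<close>, and
  \<open>e(t) = O(t - a)\<close>; this already gives a local error \<open>O(h\<^sup>2)\<close>.

  For affine \<open>w\<^sub>i\<close> the two moment conditions say that \<open>w\<^sub>i\<close> is the \<open>L\<^sup>2\<close>-orthogonal projection of \<open>v\<^sub>i\<close>, so
  that \<open>w\<^sub>i\<close> and \<open>d\<^sub>i\<close> have \<open>L\<^sup>2\<close>-norm at most that of \<open>v\<^sub>i\<close>. Moreover the first integral is integrated by
  parts against \<open>t - c\<close>: the boundary term is at most \<open>(L h / 2) \<parallel>e(b)\<parallel>\<close>; in the remaining integral the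
  terms with \<open>d\<^sub>i\<close> are \<open>O(h\<^sup>3)\<close> because \<open>(t - c) d\<^sub>i\<close> has mean zero, and the others are controlled by
  \<open>sup \<parallel>e\<parallel> \<le> 7/2 K' h E\<close>, a one-sided Gronwall estimate with the logarithmic norm.
\<close>

subsection \<open>Maximum norm, logarithmic norm and Lipschitz bounds\<close>

lemma mnorm_eq_infnorm: "mnorm x = infnorm x"
  unfolding mnorm_def infnorm_cart
  by (subst cSup_eq_Max) (auto simp: full_SetCompr_eq)

lemma component_le_mnorm: "\<bar>x $ j\<bar> \<le> mnorm x"
  unfolding mnorm_eq_infnorm by (rule component_le_infnorm_cart)

lemma mnorm_leI: "(\<And>j. \<bar>x $ j\<bar> \<le> c) \<Longrightarrow> mnorm x \<le> c"
  unfolding mnorm_def by (subst Max_le_iff) auto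

lemma mnorm_nonneg: "0 \<le> mnorm x"
  unfolding mnorm_eq_infnorm by (rule infnorm_pos_le)

lemma mnorm_zero [simp]: "mnorm 0 = 0"
  unfolding mnorm_eq_infnorm by (rule infnorm_0)

lemma mnorm_triangle: "mnorm (x + y) \<le> mnorm x + mnorm y"
  unfolding mnorm_eq_infnorm by (rule infnorm_triangle)

lemma mnorm_minus_commute: "mnorm (x - y) = mnorm (y - x)"
  unfolding mnorm_eq_infnorm by (rule infnorm_sub)

lemma abs_matrix_vector_component_le: "\<bar>(A *v u) $ k\<bar> \<le> mat_norm A * mnorm u"
proof -
  have "\<bar>(A *v u) $ k\<bar> \<le> (\<Sum>i\<in>UNIV. \<bar>A $ k $ i\<bar> * mnorm u)"
    unfolding matrix_vector_mult_def
    by (auto simp: abs_mult intro!: order_trans[OF sum_abs] sum_mono mult_left_mono component_le_mnorm)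
  also have "\<dots> \<le> mat_norm A * mnorm u"
    unfolding sum_distrib_right[symmetric] mat_norm_def
    by (intro mult_right_mono mnorm_nonneg Max_ge) auto
  finally show ?thesis .
qed

lemma abs_matrix_vector_component_le':
  assumes "mat_norm A \<le> c"
  shows "\<bar>(A *v u) $ k\<bar> \<le> c * mnorm u"
  using abs_matrix_vector_component_le[of A u k] mult_right_mono[OF assms mnorm_nonneg[of u]]
  by linarith

text \<open>The restriction on \<open>\<delta>\<close> keeps \<open>1 + \<delta> * A $ k $ k\<close>
  non-negative, so the diagonal entry survives with its sign, and row \<open>k\<close> of I +
  \<delta> A has absolute sum at most \<open>1 + \<delta> * log_norm A\<close>. The bound is stated
  per component because the mean value point supplying \<open>A\<close> will depend on
  \<open>k\<close>.\<close>

lemma abs_euler_component_le: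
  fixes A :: "real^'n^'n"
  assumes \<delta>: "0 \<le> \<delta>" "\<delta> * mat_norm A \<le> 1"
  shows "\<bar>u $ k + \<delta> * (A *v u) $ k\<bar> \<le> (1 + \<delta> * log_norm A) * mnorm u"
proof -
  let ?S = "\<Sum>i\<in>UNIV - {k}. \<bar>A $ k $ i\<bar>"
  have split: "sum q UNIV = q k + sum q (UNIV - {k})" for q :: "'n \<Rightarrow> real"
    by (rule sum.remove) auto
  have "\<bar>A $ k $ k\<bar> \<le> (\<Sum>i\<in>UNIV. \<bar>A $ k $ i\<bar>)"
    by (rule member_le_sum) auto
  also have "\<dots> \<le> mat_norm A"
    unfolding mat_norm_def by (rule Max_ge) auto
  finally have "\<delta> * \<bar>A $ k $ k\<bar> \<le> 1"
    using \<delta> mult_left_mono order_trans by blast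
  moreover have "- (\<delta> * A $ k $ k) \<le> \<delta> * \<bar>A $ k $ k\<bar>"
    using \<delta>(1) by (simp add: abs_if mult_nonneg_nonpos)
  ultimately have diag: "0 \<le> 1 + \<delta> * A $ k $ k" by linarith
  have "u $ k + \<delta> * (A *v u) $ k
      = (1 + \<delta> * A $ k $ k) * u $ k + \<delta> * (\<Sum>i\<in>UNIV - {k}. A $ k $ i * u $ i)"
    unfolding matrix_vector_mult_def by (simp add: split algebra_simps)
  also have "\<bar>\<dots>\<bar> \<le> (1 + \<delta> * A $ k $ k) * mnorm u + \<delta> * (?S * mnorm u)"
  proof (rule order_trans[OF abs_triangle_ineq] add_mono)+
    show "\<bar>(1 + \<delta> * A $ k $ k) * u $ k\<bar> \<le> (1 + \<delta> * A $ k $ k) * mnorm u"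
      using diag by (simp add: abs_mult mult_left_mono component_le_mnorm)
    have "\<bar>\<Sum>i\<in>UNIV - {k}. A $ k $ i * u $ i\<bar> \<le> ?S * mnorm u"
      unfolding sum_distrib_right
      by (auto simp: abs_mult intro!: order_trans[OF sum_abs] sum_mono mult_left_mono component_le_mnorm)
    then show "\<bar>\<delta> * (\<Sum>i\<in>UNIV - {k}. A $ k $ i * u $ i)\<bar> \<le> \<delta> * (?S * mnorm u)"
      using \<delta>(1) by (simp add: abs_mult mult_left_mono)
  qed
  also have "\<dots> = (1 + \<delta> * (A $ k $ k + ?S)) * mnorm u"
    by (simp add: algebra_simps)
  also have "\<dots> \<le> (1 + \<delta> * log_norm A) * mnorm u"
  proof -
    have "A $ k $ k + ?S \<le> log_norm A"
      unfolding log_norm_def by (rule Max_ge) auto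
    then show ?thesis
      using \<delta>(1) by (intro mult_right_mono mnorm_nonneg add_left_mono mult_left_mono)
  qed
  finally show ?thesis .
qed

text \<open>\<open>d2_norm\<close> is a supremum of reals and dominates its members only once they
  are known to be bounded above. This follows from bilinearity of \<open>D2 f z\<close> in finite
  dimension, after passing between the maximum norm and the Euclidean norm with the factor
  \<open>?c\<close>. Homogeneity then reduces general arguments to unit ones.\<close>

lemma mnorm_D2_le:
  assumes "Jac f differentiable (at z)"
  shows "mnorm (D2 f z u v) \<le> d2_norm f z * mnorm u * mnorm v"
proof -
  let ?D = "frechet_derivative (Jac f) (at z)"
  have lin: "linear ?D"
    using assms by (rule linear_frechet_derivative)
  have bil: "bilinear (D2 f z)"
    unfolding bilinear_def D2_def
    using lin by (auto intro!: linearI simp: linear_add linear_scale matrix_vector_mult_add_rdistrib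
        matrix_vector_right_distrib scaleR_matrix_vector_assoc matrix_vector_mult_scaleR)
  then obtain C where C: "C > 0" "\<And>u v. norm (D2 f z u v) \<le> C * norm u * norm v"
    using bilinear_bounded_pos by blast
  let ?c = "sqrt DIM(real^'a)"
  have bdd: "bdd_above ((\<lambda>uv. mnorm (D2 f z (fst uv) (snd uv))) ` {(u,v). mnorm u \<le> 1 \<and> mnorm v \<le> 1})"
  proof (rule bdd_aboveI2, clarsimp)
    fix u v :: "real^'a" assume uv: "mnorm u \<le> 1" "mnorm v \<le> 1"
    have n: "norm r \<le> ?c" if "mnorm r \<le> 1" for r :: "real^'a"
      by (rule order_trans[OF norm_le_infnorm])
        (use that in \<open>simp add: mnorm_eq_infnorm mult_left_le del: DIM_cart\<close>)
    have "mnorm (D2 f z u v) \<le> norm (D2 f z u v)"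
      unfolding mnorm_eq_infnorm by (rule infnorm_le_norm)
    also have "\<dots> \<le> C * norm u * norm v" by (rule C)
    also have "\<dots> \<le> C * ?c * ?c"
      using n[OF uv(1)] n[OF uv(2)] C(1) by (intro mult_mono) auto
    finally show "mnorm (D2 f z u v) \<le> C * ?c * ?c" .
  qed
  have unit: "mnorm (D2 f z p q) \<le> d2_norm f z" if "mnorm p \<le> 1" "mnorm q \<le> 1" for p q
    unfolding d2_norm_def using cSUP_upper[OF _ bdd, of "(p,q)"] that by simp
  show ?thesis
  proof (cases "u = 0 \<or> v = 0")
    case True
    then show ?thesis
      using bilinear_lzero[OF bil] bilinear_rzero[OF bil] by auto
  next
    case False
    define p q where "p = (1 / mnorm u) *\<^sub>R u" and "q = (1 / mnorm v) *\<^sub>R v"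
    have pos: "mnorm u > 0" "mnorm v > 0"
      using False unfolding mnorm_eq_infnorm by (auto simp: infnorm_pos_lt)
    have uv: "u = mnorm u *\<^sub>R p" "v = mnorm v *\<^sub>R q"
      using pos by (auto simp: p_def q_def)
    have pq: "mnorm p \<le> 1" "mnorm q \<le> 1"
      using pos unfolding p_def q_def mnorm_eq_infnorm by (auto simp: infnorm_mul)
    have "D2 f z u v = (mnorm u * mnorm v) *\<^sub>R D2 f z p q"
      by (subst uv(1), subst uv(2)) (simp add: bilinear_lmul[OF bil] bilinear_rmul[OF bil])
    then have "mnorm (D2 f z u v) = mnorm u * mnorm v * mnorm (D2 f z p q)"
      using pos unfolding mnorm_eq_infnorm by (simp add: infnorm_mul)
    also have "\<dots> \<le> mnorm u * mnorm v * d2_norm f z"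
      using unit[OF pq] pos by (intro mult_left_mono) auto
    finally show ?thesis by (simp add: mult_ac)
  qed
qed

text \<open>The one-dimensional mean value theorem along the segment from \<open>q\<close> to
  \<open>p\<close>. It is stated for scalar functions because the equality fails for vector-valued
  ones; in the maximum norm, arguing component by component loses nothing.\<close>

lemma mvt_segment:
  fixes \<phi> :: "'a::real_normed_vector \<Rightarrow> real"
  assumes B: "convex B" "p \<in> B" "q \<in> B"
    and deriv: "\<And>z. z \<in> B \<Longrightarrow> (\<phi> has_derivative \<phi>' z) (at z)"
  obtains z where "z \<in> B" "\<phi> p - \<phi> q = \<phi>' z (p - q)"
proof -
  let ?\<gamma> = "\<lambda>\<theta>::real. q + \<theta> *\<^sub>R (p - q)"
  have inB: "?\<gamma> \<theta> \<in> B" if "\<theta> \<in> {0..1}" for \<theta>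
  proof -
    have "(1 - \<theta>) *\<^sub>R q + \<theta> *\<^sub>R p \<in> B"
      using that B by (intro convexD) auto
    then show ?thesis by (simp add: algebra_simps)
  qed
  have "\<exists>\<theta>\<in>{0..1}. (\<phi> \<circ> ?\<gamma>) 1 - (\<phi> \<circ> ?\<gamma>) 0 = (\<lambda>r. \<phi>' (?\<gamma> \<theta>) (r *\<^sub>R (p - q))) (1 - 0)"
  proof (rule mvt_very_simple)
    fix \<theta> :: real assume "0 \<le> \<theta>" "\<theta> \<le> 1"
    then have "?\<gamma> \<theta> \<in> B" by (intro inB) auto
    have "(?\<gamma> has_derivative (\<lambda>r. r *\<^sub>R (p - q))) (at \<theta> within {0..1})"
      by (auto intro!: derivative_eq_intros)
    from has_derivative_compose[OF this deriv[OF \<open>?\<gamma> \<theta> \<in> B\<close>]]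
    show "(\<phi> \<circ> ?\<gamma> has_derivative (\<lambda>r. \<phi>' (?\<gamma> \<theta>) (r *\<^sub>R (p - q)))) (at \<theta> within {0..1})"
      by (simp add: o_def)
  qed auto
  then obtain \<theta> where "\<theta> \<in> {0..1}" "\<phi> p - \<phi> q = \<phi>' (?\<gamma> \<theta>) (p - q)"
    by auto
  then show ?thesis using that inB by blast
qed

section \<open>Lipschitz bounds for twice differentiable fields on a convex set\<close>

lemma C2_has_derivative:
  assumes "C2 f"
  shows "(f has_derivative (\<lambda>u. Jac f z *v u)) (at z)"
  using assms jacobian_works[of f "at z"] unfolding C2_def Jac_def[of f z] jacobian_def
  by blast

lemma C2_component_has_derivative:
  assumes "C2 f"
  shows "((\<lambda>z. f z $ k) has_derivative (\<lambda>u. (Jac f z *v u) $ k)) (at z)"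
  using bounded_linear.has_derivative[OF bounded_linear_vec_nth C2_has_derivative[OF assms]] .

lemma C2_continuous_on: "C2 f \<Longrightarrow> continuous_on S f"
  by (meson C2_has_derivative continuous_at_imp_continuous_on has_derivative_continuous)

lemma C2_Jac_has_derivative:
  assumes "C2 f"
  shows "(Jac f has_derivative frechet_derivative (Jac f) (at z)) (at z)"
  using assms unfolding C2_def frechet_derivative_works[symmetric] by blast

lemma C2_Jac_continuous_on: "C2 f \<Longrightarrow> continuous_on S (Jac f)"
  by (meson C2_Jac_has_derivative continuous_at_imp_continuous_on has_derivative_continuous)

lemma C2_lipschitz:
  assumes "C2 f" "convex B" "p \<in> B" "q \<in> B" "\<And>z. z \<in> B \<Longrightarrow> mat_norm (Jac f z) \<le> L"
  shows "mnorm (f p - f q) \<le> L * mnorm (p - q)"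
proof (rule mnorm_leI)
  fix k
  obtain z where "z \<in> B" "f p $ k - f q $ k = (Jac f z *v (p - q)) $ k"
    by (rule mvt_segment[OF assms(2-4) C2_component_has_derivative[OF assms(1), of k]])
  then show "\<bar>(f p - f q) $ k\<bar> \<le> L * mnorm (p - q)"
    using abs_matrix_vector_component_le'[OF assms(5)] by simp
qed

text \<open>For fixed \<open>u\<close> and \<open>k\<close> the scalar map
  \<open>(Jac f z *v u) $ k\<close> has derivative \<open>D2 f z r u $ k\<close> in direction
  \<open>r\<close>, so the mean value theorem applies directly to it.\<close>

lemma C2_Jac_lipschitz:
  fixes f :: "real^'n \<Rightarrow> real^'n"
  assumes f: "C2 f" and B: "convex B" "p \<in> B" "q \<in> B"
    and H: "\<And>z. z \<in> B \<Longrightarrow> d2_norm f z \<le> H"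
  shows "mnorm (Jac f p *v u - Jac f q *v u) \<le> H * mnorm (p - q) * mnorm u"
proof (rule mnorm_leI)
  fix k :: 'n
  have lin: "bounded_linear (\<lambda>M :: real^'n^'n. (M *v u) $ k)"
    by (intro bounded_linear_compose[OF bounded_linear_vec_nth]
        linear_conv_bounded_linear[THEN iffD1] linearI)
      (simp_all add: matrix_vector_mult_add_rdistrib scaleR_matrix_vector_assoc)
  have deriv: "((\<lambda>z. (Jac f z *v u) $ k) has_derivative (\<lambda>r. D2 f z r u $ k)) (at z)" for z
    unfolding D2_def using bounded_linear.has_derivative[OF lin C2_Jac_has_derivative[OF f]] .
  obtain z where z: "z \<in> B" "(Jac f p *v u) $ k - (Jac f q *v u) $ k = D2 f z (p - q) u $ k"
    by (rule mvt_segment[OF B deriv])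
  have "\<bar>D2 f z (p - q) u $ k\<bar> \<le> mnorm (D2 f z (p - q) u)"
    by (rule component_le_mnorm)
  also have "\<dots> \<le> d2_norm f z * mnorm (p - q) * mnorm u"
    using f unfolding C2_def by (blast intro: mnorm_D2_le)
  also have "\<dots> \<le> H * mnorm (p - q) * mnorm u"
    using H[OF z(1)] by (intro mult_right_mono mnorm_nonneg)
  finally show "\<bar>(Jac f p *v u - Jac f q *v u) $ k\<bar> \<le> H * mnorm (p - q) * mnorm u"
    using z(2) by simp
qed

text \<open>Inserting \<open>Jac f q *v g p\<close> separates the change of the Jacobian, which
  costs \<open>H * K\<^sub>g\<close>, from the change of the field, which costs
  \<open>L * L\<^sub>g\<close>. Such products arise when \<open>f\<close> is differentiated along a
  solution.\<close>

lemma C2_Jac_mult_lipschitz: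
  assumes f: "C2 f" and g: "C2 g" and B: "convex B" "p \<in> B" "q \<in> B"
    and L: "\<And>z. z \<in> B \<Longrightarrow> mat_norm (Jac f z) \<le> L"
    and H: "\<And>z. z \<in> B \<Longrightarrow> d2_norm f z \<le> H"
    and K\<^sub>g: "\<And>z. z \<in> B \<Longrightarrow> mnorm (g z) \<le> K\<^sub>g"
    and L\<^sub>g: "\<And>z. z \<in> B \<Longrightarrow> mat_norm (Jac g z) \<le> L\<^sub>g"
    and nonneg: "0 \<le> L" "0 \<le> H"
  shows "\<bar>(Jac f p *v g p) $ k - (Jac f q *v g q) $ k\<bar> \<le> (H * K\<^sub>g + L * L\<^sub>g) * mnorm (p - q)"
proof -
  have "\<bar>(Jac f p *v g p - Jac f q *v g p) $ k\<bar> \<le> H * mnorm (p - q) * mnorm (g p)"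
    by (rule order_trans[OF component_le_mnorm C2_Jac_lipschitz[OF f B H]])
  also have "\<dots> \<le> H * mnorm (p - q) * K\<^sub>g"
    using K\<^sub>g[OF B(2)] nonneg by (intro mult_left_mono mult_nonneg_nonneg mnorm_nonneg)
  finally have 1: "\<bar>(Jac f p *v g p - Jac f q *v g p) $ k\<bar> \<le> H * mnorm (p - q) * K\<^sub>g" .
  have "\<bar>(Jac f q *v (g p - g q)) $ k\<bar> \<le> L * mnorm (g p - g q)"
    by (rule abs_matrix_vector_component_le'[OF L[OF B(3)]])
  also have "\<dots> \<le> L * (L\<^sub>g * mnorm (p - q))"
    using C2_lipschitz[OF g B L\<^sub>g] nonneg by (intro mult_left_mono)
  finally have 2: "\<bar>(Jac f q *v (g p - g q)) $ k\<bar> \<le> L * (L\<^sub>g * mnorm (p - q))" .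
  have "(Jac f p *v g p) $ k - (Jac f q *v g q) $ k
      = (Jac f p *v g p - Jac f q *v g p) $ k + (Jac f q *v (g p - g q)) $ k"
    by (simp add: matrix_vector_mult_diff_distrib)
  with 1 2 show ?thesis by (simp add: algebra_simps)
qed

lemma mat_norm_nonneg: "0 \<le> mat_norm A"
  unfolding mat_norm_def by (subst Max_ge_iff) (auto intro!: sum_nonneg)

lemma d2_norm_nonneg:
  assumes "Jac f differentiable (at z)"
  shows "0 \<le> d2_norm f z"
proof -
  \<comment> \<open>The all-ones vector has maximum norm 1; used in both arguments of
    \<open>mnorm_D2_le\<close> it leaves \<open>d2_norm f z\<close> alone on the right.\<close>
  have "mnorm (vec 1 :: real^'a) = 1"
    unfolding mnorm_def by simp
  then show ?thesis
    using mnorm_D2_le[OF assms, of "vec 1" "vec 1"] mnorm_nonneg[of "D2 f z (vec 1) (vec 1)"]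
    by simp
qed

subsection \<open>Integral estimates\<close>

lemma bounded_measurable_integrable:
  fixes u :: "real \<Rightarrow> real"
  assumes "u \<in> borel_measurable (lebesgue_on {a..b})" "\<And>t. t \<in> {a..b} \<Longrightarrow> \<bar>u t\<bar> \<le> U"
  shows "u integrable_on {a..b}"
  by (rule measurable_bounded_by_integrable_imp_integrable[OF assms(1) integrable_const_ivl[of U]])
    (use assms(2) in auto)

lemma bounded_measurable_times_continuous_integrable:
  fixes u c :: "real \<Rightarrow> real"
  assumes u: "u \<in> borel_measurable (lebesgue_on {a..b})" "\<And>t. t \<in> {a..b} \<Longrightarrow> \<bar>u t\<bar> \<le> U"
    and c: "continuous_on {a..b} c"
  shows "(\<lambda>t. u t * c t) integrable_on {a..b}"
proof -
  have "compact (c ` {a..b})"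
    by (intro compact_continuous_image c compact_Icc)
  then obtain C where C: "\<And>t. t \<in> {a..b} \<Longrightarrow> \<bar>c t\<bar> \<le> C"
    by (metis compact_imp_bounded bounded_iff imageI real_norm_def)
  have "c \<in> borel_measurable (lebesgue_on {a..b})"
    by (intro continuous_imp_measurable_on_sets_lebesgue c) auto
  with u(1) have "(\<lambda>t. u t * c t) \<in> borel_measurable (lebesgue_on {a..b})"
    by (rule borel_measurable_times)
  moreover have "\<bar>u t * c t\<bar> \<le> U * C" if "t \<in> {a..b}" for t
    unfolding abs_mult using u(2)[OF that] C[OF that]
    by (intro mult_mono) auto
  ultimately show ?thesis
    by (rule bounded_measurable_integrable)
qed

section \<open>Centered moments and square-integral bounds for affine controls\<close>

lemma integral_abs_centered:
  fixes a b :: real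
  assumes "a \<le> b"
  shows "integral {a..b} (\<lambda>t. \<bar>t - (a + b) / 2\<bar>) = (b - a)\<^sup>2 / 4"
proof -
  define c where "c = (a + b) / 2"
  have c: "a \<le> c" "c \<le> b" using assms by (auto simp: c_def)
  have 1: "((\<lambda>t. \<bar>t - c\<bar>) has_integral (- (c - c)\<^sup>2 / 2 - - (a - c)\<^sup>2 / 2)) {a..c}"
    using c
    by (intro fundamental_theorem_of_calculus)
      (auto intro!: derivative_eq_intros simp: field_simps has_real_derivative_iff_has_vector_derivative[symmetric])
  have 2: "((\<lambda>t. \<bar>t - c\<bar>) has_integral ((b - c)\<^sup>2 / 2 - (c - c)\<^sup>2 / 2)) {c..b}"
    using c
    by (intro fundamental_theorem_of_calculus)
      (auto intro!: derivative_eq_intros simp: has_real_derivative_iff_has_vector_derivative[symmetric])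
  have "((\<lambda>t. \<bar>t - c\<bar>) has_integral ((b - a)\<^sup>2 / 4)) {a..b}"
    by (rule has_integral_eq_rhs[OF has_integral_combine[OF _ _ 1 2]])
      (use c in \<open>auto simp: c_def field_simps power2_eq_square\<close>)
  then show ?thesis by (simp add: c_def integral_unique)
qed

lemma has_integral_shifted_power:
  fixes a b c :: real
  assumes "a \<le> b"
  shows "((\<lambda>t. (t - c) ^ n) has_integral ((b - c) ^ Suc n - (a - c) ^ Suc n) / (n + 1)) {a..b}"
proof -
  have "((\<lambda>t. (t - c) ^ n) has_integral (b - c) ^ Suc n / (n + 1) - (a - c) ^ Suc n / (n + 1)) {a..b}"
    using assms
    by (intro fundamental_theorem_of_calculus)
      (auto intro!: derivative_eq_intros simp: has_real_derivative_iff_has_vector_derivative[symmetric]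
        simp del: power_Suc)
  then show ?thesis by (simp add: diff_divide_distrib)
qed

text \<open>By the moment conditions \<open>v - w\<close> is orthogonal to 1 and to t - c, hence to
  \<open>w\<close>, and Pythagoras bounds the square integrals of both \<open>w\<close> and
  \<open>v - w\<close> by that of \<open>v\<close>. An affine function is determined by its value at
  the midpoint and its slope, so its square integral also controls its supremum.\<close>

lemma affine_projection:
  fixes v w :: "real \<Rightarrow> real"
  assumes ab: "a < b"
    and v: "v \<in> borel_measurable (lebesgue_on {a..b})" "\<And>t. t \<in> {a..b} \<Longrightarrow> \<bar>v t\<bar> \<le> V"
    and w: "\<And>t. t \<in> {a..b} \<Longrightarrow> w t = p + q * t"
    and mom0: "integral {a..b} (\<lambda>t. v t - w t) = 0"
    and mom1: "integral {a..b} (\<lambda>t. (t - (a + b) / 2) * (v t - w t)) = 0"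
  shows affine_projection_L2: "integral {a..b} (\<lambda>t. (w t)\<^sup>2) \<le> V\<^sup>2 * (b - a)"
    and affine_projection_L2_diff: "integral {a..b} (\<lambda>t. (v t - w t)\<^sup>2) \<le> V\<^sup>2 * (b - a)"
    and affine_projection_sup: "t \<in> {a..b} \<Longrightarrow> \<bar>w t\<bar> \<le> 2 * V"
proof -
  define c where "c = (a + b) / 2"
  define \<alpha> where "\<alpha> = p + q * c"
  have w': "w t = \<alpha> + q * (t - c)" if "t \<in> {a..b}" for t
    using w[OF that] by (simp add: \<alpha>_def algebra_simps)
  have cw: "continuous_on {a..b} w"
    by (subst continuous_on_cong[OF refl w]) (auto intro!: continuous_intros)
  have mw: "w \<in> borel_measurable (lebesgue_on {a..b})"
    by (intro continuous_imp_measurable_on_sets_lebesgue cw) auto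
  have V: "0 \<le> V" using v(2)[of a] ab by force
  let ?d = "\<lambda>t. v t - w t"
  have iv: "(\<lambda>t. v t * r t) integrable_on {a..b}" if "continuous_on {a..b} r" for r
    by (rule bounded_measurable_times_continuous_integrable[OF v that])
  have id: "(\<lambda>t. ?d t * r t) integrable_on {a..b}" if "continuous_on {a..b} r" for r
    unfolding left_diff_distrib
    by (intro integrable_diff iv that integrable_continuous_real continuous_intros cw)
  have iw2: "(\<lambda>t. (w t)\<^sup>2) integrable_on {a..b}"
    by (intro integrable_continuous_real continuous_intros cw)
  have iv2: "(\<lambda>t. (v t)\<^sup>2) integrable_on {a..b}"
  proof (rule bounded_measurable_integrable)
    show "(\<lambda>t. (v t)\<^sup>2) \<in> borel_measurable (lebesgue_on {a..b})"
      using v(1) by (intro borel_measurable_power)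
    show "\<bar>(v t)\<^sup>2\<bar> \<le> V\<^sup>2" if "t \<in> {a..b}" for t
      using v(2)[OF that] by (simp add: abs_le_square_iff[symmetric] V)
  qed
  \<comment> \<open>\<open>w\<close> is a combination of the constant 1 and t - c, the two functions
    in the moment conditions.\<close>
  have orth: "integral {a..b} (\<lambda>t. ?d t * w t) = 0"
  proof -
    have "integral {a..b} (\<lambda>t. ?d t * w t) = integral {a..b} (\<lambda>t. \<alpha> * ?d t + q * ((t - c) * ?d t))"
      by (rule integral_cong) (simp add: w' algebra_simps)
    also have "\<dots> = integral {a..b} (\<lambda>t. \<alpha> * ?d t) + integral {a..b} (\<lambda>t. q * ((t - c) * ?d t))"
    proof (rule integral_add)
      show "(\<lambda>t. \<alpha> * ?d t) integrable_on {a..b}"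
        using id[of "\<lambda>_. \<alpha>"] by (simp add: mult.commute)
      show "(\<lambda>t. q * ((t - c) * ?d t)) integrable_on {a..b}"
        using id[of "\<lambda>t. q * (t - c)"] by (simp add: continuous_intros mult_ac)
    qed
    also have "\<dots> = 0"
      using mom0 mom1 by (simp add: c_def)
    finally show ?thesis .
  qed
  have id2: "(\<lambda>t. (?d t)\<^sup>2) integrable_on {a..b}"
  proof -
    have "(\<lambda>t. (v t)\<^sup>2 - 2 * (v t * w t) + (w t)\<^sup>2) integrable_on {a..b}"
      by (intro integrable_add integrable_diff iv2 iw2 integrable_on_mult_right iv cw)
    then show ?thesis by (simp add: power2_diff algebra_simps)
  qed
  have "integral {a..b} (\<lambda>t. (v t)\<^sup>2)
      = integral {a..b} (\<lambda>t. (?d t)\<^sup>2 + (2 * (?d t * w t) + (w t)\<^sup>2))"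
    by (rule integral_cong) (simp add: power2_eq_square algebra_simps)
  also have "\<dots> = integral {a..b} (\<lambda>t. (?d t)\<^sup>2) + (integral {a..b} (\<lambda>t. 2 * (?d t * w t)) + integral {a..b} (\<lambda>t. (w t)\<^sup>2))"
    using integral_add[OF id2 integrable_add[OF integrable_on_mult_right[OF id[OF cw], of 2] iw2]]
      integral_add[OF integrable_on_mult_right[OF id[OF cw], of 2] iw2] by simp
  finally have pyth: "integral {a..b} (\<lambda>t. (v t)\<^sup>2)
      = integral {a..b} (\<lambda>t. (?d t)\<^sup>2) + integral {a..b} (\<lambda>t. (w t)\<^sup>2)"
    using orth by simp
  have "integral {a..b} (\<lambda>t. (v t)\<^sup>2) \<le> integral {a..b} (\<lambda>t. V\<^sup>2)"
    by (intro integral_le iv2) (use v(2) V in \<open>auto simp: abs_le_square_iff[symmetric]\<close>)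
  then have vV: "integral {a..b} (\<lambda>t. (v t)\<^sup>2) \<le> V\<^sup>2 * (b - a)"
    using ab by (simp add: mult.commute)
  have nn: "0 \<le> integral {a..b} (\<lambda>t. (?d t)\<^sup>2)" "0 \<le> integral {a..b} (\<lambda>t. (w t)\<^sup>2)"
    by (intro integral_nonneg id2 iw2; simp)+
  show L2: "integral {a..b} (\<lambda>t. (w t)\<^sup>2) \<le> V\<^sup>2 * (b - a)"
    and "integral {a..b} (\<lambda>t. (v t - w t)\<^sup>2) \<le> V\<^sup>2 * (b - a)"
    using pyth vV nn by linarith+
  \<comment> \<open>The square integral of \<open>w\<close> in closed form: about the midpoint the
    mixed term integrates to zero and the square of t - c integrates to (b - a)^3 / 12.\<close>
  have "((\<lambda>t. \<alpha>\<^sup>2 + 2 * \<alpha> * q * (t - c) ^ 1 + q\<^sup>2 * (t - c) ^ 2) has_integral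
      (\<alpha>\<^sup>2 * (b - a) + 2 * \<alpha> * q * (((b - c) ^ Suc 1 - (a - c) ^ Suc 1) / (1 + 1))
       + q\<^sup>2 * (((b - c) ^ Suc 2 - (a - c) ^ Suc 2) / (2 + 1)))) {a..b}"
    using has_integral_shifted_power[of a b c 1] has_integral_shifted_power[of a b c 2]
      has_integral_const_real[of "\<alpha>\<^sup>2" a b] ab
    by (intro has_integral_add has_integral_mult_right) (simp_all add: mult.commute)
  then have "((\<lambda>t. (w t)\<^sup>2) has_integral \<alpha>\<^sup>2 * (b - a) + q\<^sup>2 * ((b - a) ^ 3 / 12)) {a..b}"
  proof (rule has_integral_eq_rhs[OF has_integral_eq, rotated])
    show "\<alpha>\<^sup>2 * (b - a) + q\<^sup>2 * ((b - a) ^ 3 / 12) = \<alpha>\<^sup>2 * (b - a)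
        + 2 * \<alpha> * q * (((b - c) ^ Suc 1 - (a - c) ^ Suc 1) / (1 + 1))
        + q\<^sup>2 * (((b - c) ^ Suc 2 - (a - c) ^ Suc 2) / (2 + 1))"
      by (simp add: c_def field_simps power2_eq_square power3_eq_cube)
  qed (simp add: w' power2_eq_square algebra_simps)
  then have "(\<alpha>\<^sup>2 + q\<^sup>2 * (b - a)\<^sup>2 / 12) * (b - a) \<le> V\<^sup>2 * (b - a)"
    using L2 by (simp add: integral_unique algebra_simps power3_eq_cube power2_eq_square)
  then have \<alpha>q: "\<alpha>\<^sup>2 + q\<^sup>2 * (b - a)\<^sup>2 / 12 \<le> V\<^sup>2"
    using ab by simp
  show "\<bar>w t\<bar> \<le> 2 * V" if t: "t \<in> {a..b}"
  proof -
    define r where "r = q * (t - c)"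
    have "\<bar>t - c\<bar> \<le> \<bar>(b - a) / 2\<bar>"
      using t by (auto simp: c_def abs_if field_simps)
    then have "(t - c)\<^sup>2 \<le> ((b - a) / 2)\<^sup>2"
      by (rule abs_le_square_iff[THEN iffD1])
    then have "q\<^sup>2 * (t - c)\<^sup>2 \<le> q\<^sup>2 * ((b - a) / 2)\<^sup>2"
      by (intro mult_left_mono) auto
    then have "r\<^sup>2 / 3 \<le> q\<^sup>2 * (b - a)\<^sup>2 / 12"
      by (simp add: r_def power_mult_distrib power_divide)
    then have "\<alpha>\<^sup>2 + r\<^sup>2 / 3 \<le> V\<^sup>2"
      using \<alpha>q by linarith
    \<comment> \<open>This is Cauchy-Schwarz with weights 1 and 3: 4 (\<alpha>^2 + r^2 / 3) -
      (\<alpha> + r)^2 equals (3 \<alpha> - r)^2 / 3. The factor 4 becomes the 2 in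
      \<open>2 * V\<close>.\<close>
    moreover have "0 \<le> (3 * \<alpha> - r)\<^sup>2" by simp
    ultimately have "(\<alpha> + r)\<^sup>2 \<le> (2 * V)\<^sup>2"
      by (simp add: power2_eq_square algebra_simps)
    then have "\<bar>\<alpha> + r\<bar> \<le> \<bar>2 * V\<bar>"
      by (rule abs_le_square_iff[THEN iffD2])
    then show ?thesis
      using V by (simp add: w'[OF t] r_def)
  qed
qed

text \<open>Cauchy-Schwarz in the form of a weighted arithmetic-geometric mean inequality,
  integrated pointwise. For positive \<open>I\<close> the best \<kappa> would give V times the
  square root of I (b - a); leaving \<kappa> free permits rational constants.\<close>

lemma integral_weighted_le_L2:
  fixes \<rho> d :: "real \<Rightarrow> real"
  assumes ab: "a < b"
    and d: "d \<in> borel_measurable (lebesgue_on {a..b})" "\<And>t. t \<in> {a..b} \<Longrightarrow> \<bar>d t\<bar> \<le> D"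
    and \<rho>: "continuous_on {a..b} \<rho>" "\<And>t. t \<in> {a..b} \<Longrightarrow> 0 \<le> \<rho> t"
    and I: "integral {a..b} (\<lambda>t. (\<rho> t)\<^sup>2) = I"
    and V: "0 < V" "integral {a..b} (\<lambda>t. (d t)\<^sup>2) \<le> V\<^sup>2 * (b - a)"
    and \<kappa>: "0 < \<kappa>"
  shows "integral {a..b} (\<lambda>t. \<bar>d t\<bar> * \<rho> t) \<le> V * (\<kappa> * I + (b - a) / \<kappa>) / 2"
proof -
  have \<rho>2: "(\<lambda>t. (\<rho> t)\<^sup>2) integrable_on {a..b}"
    by (intro integrable_continuous_real continuous_intros \<rho>)
  have d2: "(\<lambda>t. (d t)\<^sup>2) integrable_on {a..b}"
  proof (rule bounded_measurable_integrable)
    show "(\<lambda>t. (d t)\<^sup>2) \<in> borel_measurable (lebesgue_on {a..b})"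
      using d(1) by (intro borel_measurable_power)
    show "\<bar>(d t)\<^sup>2\<bar> \<le> \<bar>D\<bar>\<^sup>2" if "t \<in> {a..b}" for t
      using d(2)[OF that] by (simp add: abs_le_square_iff[symmetric] del: power2_abs)
  qed
  have "integral {a..b} (\<lambda>t. \<bar>d t\<bar> * \<rho> t)
      \<le> integral {a..b} (\<lambda>t. (V * \<kappa> / 2) * (\<rho> t)\<^sup>2 + (1 / (2 * V * \<kappa>)) * (d t)\<^sup>2)"
  proof (rule integral_le)
    show "(\<lambda>t. \<bar>d t\<bar> * \<rho> t) integrable_on {a..b}"
      by (rule bounded_measurable_times_continuous_integrable[of _ _ _ D])
        (use d \<rho> in \<open>auto intro: borel_measurable_abs\<close>)
    show "(\<lambda>t. (V * \<kappa> / 2) * (\<rho> t)\<^sup>2 + (1 / (2 * V * \<kappa>)) * (d t)\<^sup>2) integrable_on {a..b}"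
      by (intro integrable_add integrable_on_mult_right \<rho>2 d2)
    fix t
    have "0 \<le> (V * \<kappa> * \<rho> t - \<bar>d t\<bar>)\<^sup>2 / (2 * V * \<kappa>)"
      using V \<kappa> by simp
    also have "\<dots> = (V * \<kappa> / 2) * (\<rho> t)\<^sup>2 + (1 / (2 * V * \<kappa>)) * (d t)\<^sup>2 - \<bar>d t\<bar> * \<rho> t"
      using V \<kappa> by (simp add: power2_diff power_mult_distrib field_simps power2_eq_square)
    finally show "\<bar>d t\<bar> * \<rho> t \<le> (V * \<kappa> / 2) * (\<rho> t)\<^sup>2 + (1 / (2 * V * \<kappa>)) * (d t)\<^sup>2"
      by simp
  qed
  also have "\<dots> = (V * \<kappa> / 2) * I + (1 / (2 * V * \<kappa>)) * integral {a..b} (\<lambda>t. (d t)\<^sup>2)"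
    using I integral_add[OF integrable_on_mult_right[OF \<rho>2, of "V * \<kappa> / 2"]
        integrable_on_mult_right[OF d2, of "1 / (2 * V * \<kappa>)"]] by simp
  also have "\<dots> \<le> (V * \<kappa> / 2) * I + (1 / (2 * V * \<kappa>)) * (V\<^sup>2 * (b - a))"
    using V \<kappa> by (intro add_left_mono mult_left_mono) auto
  also have "\<dots> = V * (\<kappa> * I + (b - a) / \<kappa>) / 2"
    using V \<kappa> by (simp add: field_simps power2_eq_square)
  finally show ?thesis .
qed

text \<open>Freezing the coefficient at \<open>t\<close> leaves the integrand
  \<open>(c \<sigma> - c t) \<bullet> F \<sigma>\<close>, which tends to 0 at \<open>t\<close>
  because \<open>F\<close> is bounded and \<open>c\<close> continuous. Its indefinite integral
  therefore has derivative 0 at \<open>t\<close>, even where \<open>F\<close> is discontinuous and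
  \<open>x\<close> has no derivative.\<close>

lemma indefinite_integral_tangent:
  fixes c F x :: "real \<Rightarrow> 'a::euclidean_space"
  assumes x: "\<And>t. t \<in> {a..b} \<Longrightarrow> (F has_integral (x t - x a)) {a..t}"
    and F: "\<And>t. t \<in> {a..b} \<Longrightarrow> norm (F t) \<le> M"
    and c: "continuous_on {a..b} c"
    and int: "(\<lambda>t. c t \<bullet> F t) integrable_on {a..b}"
    and t: "t \<in> {a..b}"
  shows "((\<lambda>\<tau>. integral {a..\<tau>} (\<lambda>\<sigma>. c \<sigma> \<bullet> F \<sigma>) - c t \<bullet> x \<tau>) has_real_derivative 0) (at t within {a..b})"
proof -
  let ?r = "\<lambda>\<sigma>. (c \<sigma> - c t) \<bullet> F \<sigma>"
  have ab: "b \<in> {a..b}" using t by auto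
  have iF: "(\<lambda>\<sigma>. c t \<bullet> F \<sigma>) integrable_on {a..b}"
    using has_integral_linear[OF x[OF ab] bounded_linear_inner_right[of "c t"]]
    unfolding o_def by blast
  have ir: "?r integrable_on {a..b}"
    unfolding inner_diff_left by (intro integrable_diff int iF)
  have "continuous (at t within {a..b} - {}) ?r"
  proof -
    have "((\<lambda>\<sigma>. norm (c \<sigma> - c t) * M) \<longlongrightarrow> norm (c t - c t) * M) (at t within {a..b})"
      using c t by (intro tendsto_intros) (auto simp: continuous_on_def)
    then have "((\<lambda>\<sigma>. norm (c \<sigma> - c t) * M) \<longlongrightarrow> 0) (at t within {a..b})"
      by simp
    then have "(?r \<longlongrightarrow> 0) (at t within {a..b})"
    proof (rule tendsto_0_le[where K = 1])
      show "\<forall>\<^sub>F \<sigma> in at t within {a..b}. norm (?r \<sigma>) \<le> norm (norm (c \<sigma> - c t) * M) * 1"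
        unfolding eventually_at_filter
      proof (intro always_eventually allI impI)
        fix \<sigma> assume "\<sigma> \<in> {a..b}"
        then have "norm (F \<sigma>) \<le> M" by (rule F)
        have "norm (?r \<sigma>) \<le> norm (c \<sigma> - c t) * norm (F \<sigma>)"
          by (simp add: Cauchy_Schwarz_ineq2)
        also have "\<dots> \<le> norm (c \<sigma> - c t) * M"
          by (intro mult_left_mono \<open>norm (F \<sigma>) \<le> M\<close>) simp
        finally show "norm (?r \<sigma>) \<le> norm (norm (c \<sigma> - c t) * M) * 1"
          by simp
      qed
    qed
    then show ?thesis by (simp add: continuous_within)
  qed
  from integral_has_vector_derivative_continuous_at[OF ir _ _ this]
  have "((\<lambda>\<tau>. integral {a..\<tau>} ?r) has_real_derivative 0) (at t within {a..b})"
    using t by (simp add: has_real_derivative_iff_has_vector_derivative)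
  from DERIV_add[OF this DERIV_const[of "- (c t \<bullet> x a)"]]
  have "((\<lambda>\<tau>. integral {a..\<tau>} ?r - c t \<bullet> x a) has_real_derivative 0) (at t within {a..b})"
    by simp
  then show ?thesis
  proof (rule has_field_derivative_transform_within[OF _ zero_less_one t])
    fix \<tau> assume \<tau>: "\<tau> \<in> {a..b}"
    have sub: "{a..\<tau>} \<subseteq> {a..b}" using \<tau> by auto
    have "integral {a..\<tau>} ?r = integral {a..\<tau>} (\<lambda>\<sigma>. c \<sigma> \<bullet> F \<sigma>) - integral {a..\<tau>} (\<lambda>\<sigma>. c t \<bullet> F \<sigma>)"
      unfolding inner_diff_left
      by (intro integral_diff integrable_subinterval_real[OF int sub] integrable_subinterval_real[OF iF sub])
    also have "integral {a..\<tau>} (\<lambda>\<sigma>. c t \<bullet> F \<sigma>) = c t \<bullet> (x \<tau> - x a)"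
      using has_integral_linear[OF x[OF \<tau>] bounded_linear_inner_right[of "c t"]]
      unfolding o_def by (rule integral_unique)
    finally show "integral {a..\<tau>} ?r - c t \<bullet> x a = integral {a..\<tau>} (\<lambda>\<sigma>. c \<sigma> \<bullet> F \<sigma>) - c t \<bullet> x \<tau>"
      by (simp add: inner_diff_right)
  qed
qed

text \<open>A chain rule at a point where the inner curve need not be differentiable: a remainder of
  smaller order than the distance in space is, along a Lipschitz curve, of smaller order than the
  distance in time.\<close>

lemma has_derivative_zero_compose_lipschitz:
  fixes x :: "real \<Rightarrow> 'a::real_normed_vector" and r :: "'a \<Rightarrow> real"
  assumes r: "(r has_derivative (\<lambda>_. 0)) (at (x t))"
    and x: "\<And>\<tau>. \<tau> \<in> S \<Longrightarrow> norm (x \<tau> - x t) \<le> C * \<bar>\<tau> - t\<bar>"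
  shows "((\<lambda>\<tau>. r (x \<tau>)) has_real_derivative 0) (at t within S)"
proof -
  have "((\<lambda>\<tau>. r (x \<tau>)) has_derivative (\<lambda>_. 0)) (at t within S)"
    unfolding has_derivative_within_alt
  proof (intro conjI allI impI)
    fix e :: real assume "e > 0"
    \<comment> \<open>The factor \<open>\<bar>C\<bar> + 1\<close> is positive for every
      \<open>C\<close> and dominates it, so it can be divided by.\<close>
    define e' where "e' = e / (\<bar>C\<bar> + 1)"
    have "e' > 0" using \<open>e > 0\<close> by (simp add: e'_def add_nonneg_pos)
    then obtain d where d: "d > 0" "\<And>z. norm (z - x t) < d \<Longrightarrow> \<bar>r z - r (x t)\<bar> \<le> e' * norm (z - x t)"
      using r unfolding has_derivative_at_alt by auto
    show "\<exists>d>0. \<forall>\<tau>\<in>S. norm (\<tau> - t) < d \<longrightarrow> norm (r (x \<tau>) - r (x t) - 0) \<le> e * norm (\<tau> - t)"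
    proof (intro exI[of _ "d / (\<bar>C\<bar> + 1)"] conjI ballI impI)
      show "d / (\<bar>C\<bar> + 1) > 0" using d by (simp add: add_nonneg_pos)
      fix \<tau> assume \<tau>: "\<tau> \<in> S" "norm (\<tau> - t) < d / (\<bar>C\<bar> + 1)"
      have "norm (x \<tau> - x t) \<le> (\<bar>C\<bar> + 1) * \<bar>\<tau> - t\<bar>"
        by (rule order_trans[OF x[OF \<tau>(1)] mult_right_mono]) auto
      moreover have "(\<bar>C\<bar> + 1) * \<bar>\<tau> - t\<bar> < d"
        using \<tau>(2) by (simp add: pos_less_divide_eq mult.commute add_nonneg_pos)
      ultimately have "\<bar>r (x \<tau>) - r (x t)\<bar> \<le> e' * ((\<bar>C\<bar> + 1) * \<bar>\<tau> - t\<bar>)"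
        using d(2)[of "x \<tau>"] \<open>e' > 0\<close> by (meson less_imp_le mult_left_mono order_le_less_trans order_trans)
      also have "\<dots> = e * \<bar>\<tau> - t\<bar>"
        by (simp add: e'_def add_nonneg_eq_0_iff)
      finally show "norm (r (x \<tau>) - r (x t) - 0) \<le> e * norm (\<tau> - t)" by simp
    qed
  qed simp
  then show ?thesis by (simp add: has_field_derivative_def lambda_zero)
qed

text \<open>The vanishing moment allows the constant \<open>\<phi> c\<close> to be subtracted from
  \<phi>, so only the variation of \<phi> counts, which gains a factor |t - c|. With \<rho> = 1 this
  exploits the mean condition, with \<rho> = t - c the first-moment condition.\<close>

lemma abs_integral_centered_le:
  fixes d \<rho> \<phi> :: "real \<Rightarrow> real"
  assumes d: "d \<in> borel_measurable (lebesgue_on {a..b})" "\<And>t. t \<in> {a..b} \<Longrightarrow> \<bar>d t\<bar> \<le> D"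
    and \<rho>: "continuous_on {a..b} \<rho>" and \<phi>: "continuous_on {a..b} \<phi>"
    and mom: "integral {a..b} (\<lambda>t. d t * \<rho> t) = 0"
    and lip: "\<And>t. t \<in> {a..b} \<Longrightarrow> \<bar>\<phi> t - \<phi> c\<bar> \<le> C * \<bar>t - c\<bar>"
  shows "\<bar>integral {a..b} (\<lambda>t. d t * (\<rho> t * \<phi> t))\<bar> \<le> C * integral {a..b} (\<lambda>t. \<bar>d t\<bar> * (\<bar>\<rho> t\<bar> * \<bar>t - c\<bar>))"
proof -
  note int = bounded_measurable_times_continuous_integrable[OF d]
  have "integral {a..b} (\<lambda>t. d t * (\<rho> t * \<phi> t))
      = integral {a..b} (\<lambda>t. d t * (\<rho> t * \<phi> t)) - \<phi> c * integral {a..b} (\<lambda>t. d t * \<rho> t)"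
    by (simp add: mom)
  also have "\<dots> = integral {a..b} (\<lambda>t. d t * (\<rho> t * \<phi> t) - \<phi> c * (d t * \<rho> t))"
    by (subst integral_diff) (auto intro!: int integrable_on_mult_right continuous_intros \<rho> \<phi>)
  also have "norm \<dots> \<le> integral {a..b} (\<lambda>t. C * (\<bar>d t\<bar> * (\<bar>\<rho> t\<bar> * \<bar>t - c\<bar>)))"
  proof (rule integral_norm_bound_integral)
    show "(\<lambda>t. d t * (\<rho> t * \<phi> t) - \<phi> c * (d t * \<rho> t)) integrable_on {a..b}"
      by (intro int integrable_diff integrable_on_mult_right continuous_intros \<rho> \<phi>)
    show "(\<lambda>t. C * (\<bar>d t\<bar> * (\<bar>\<rho> t\<bar> * \<bar>t - c\<bar>))) integrable_on {a..b}"
      by (rule integrable_on_mult_right, rule bounded_measurable_times_continuous_integrable[where U = D])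
        (use d in \<open>auto intro!: borel_measurable_abs continuous_intros \<rho>\<close>)
    fix t assume t: "t \<in> {a..b}"
    have "norm (d t * (\<rho> t * \<phi> t) - \<phi> c * (d t * \<rho> t)) = \<bar>d t\<bar> * \<bar>\<rho> t\<bar> * \<bar>\<phi> t - \<phi> c\<bar>"
      by (simp add: abs_mult[symmetric] algebra_simps)
    also have "\<dots> \<le> \<bar>d t\<bar> * \<bar>\<rho> t\<bar> * (C * \<bar>t - c\<bar>)"
      by (intro mult_left_mono lip t) auto
    finally show "norm (d t * (\<rho> t * \<phi> t) - \<phi> c * (d t * \<rho> t)) \<le> C * (\<bar>d t\<bar> * (\<bar>\<rho> t\<bar> * \<bar>t - c\<bar>))"
      by (simp add: mult_ac)
  qed
  finally show ?thesis by simp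
qed

subsection \<open>A one-sided Gronwall inequality\<close>

text \<open>For \<open>\<Lambda> < 0\<close> the bound \<open>(1 + \<delta>\<Lambda>)\<^sup>n \<le> exp (n\<delta>\<Lambda>)\<close> points the wrong way after division by \<open>\<Lambda>\<close>,
  hence the limit over ever finer Euler grids.\<close>

lemma gronwall_one_sided:
  fixes u :: "real \<Rightarrow> real"
  assumes \<Lambda>: "\<Lambda> \<noteq> 0" and ua: "u a \<le> 0" and t: "t \<in> {a..b}"
    and step: "\<And>\<epsilon>. \<epsilon> > 0 \<Longrightarrow> \<exists>\<delta>\<^sub>0>0. \<forall>s \<delta>. a \<le> s \<and> 0 < \<delta> \<and> \<delta> < \<delta>\<^sub>0 \<and> s + \<delta> \<le> b \<longrightarrow>
      u (s + \<delta>) \<le> (1 + \<delta> * \<Lambda>) * u s + \<delta> * (R + \<epsilon>)"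
  shows "u t \<le> R * ((exp (\<Lambda> * (t - a)) - 1) / \<Lambda>)"
proof (cases "t = a")
  case True
  then show ?thesis using ua by simp
next
  case False
  define T where "T = t - a"
  have T: "T > 0" using t False by (simp add: T_def)
  have bound: "u t \<le> (R + \<epsilon>) * ((exp (\<Lambda> * T) - 1) / \<Lambda>)" if "\<epsilon> > 0" for \<epsilon>
  proof -
    obtain \<delta>\<^sub>0 where \<delta>\<^sub>0: "\<delta>\<^sub>0 > 0"
      "\<And>s \<delta>. a \<le> s \<Longrightarrow> 0 < \<delta> \<Longrightarrow> \<delta> < \<delta>\<^sub>0 \<Longrightarrow> s + \<delta> \<le> b \<Longrightarrow>
        u (s + \<delta>) \<le> (1 + \<delta> * \<Lambda>) * u s + \<delta> * (R + \<epsilon>)"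
      using step[OF \<open>\<epsilon> > 0\<close>] by blast
    \<comment> \<open>The bound produced by \<open>n\<close> Euler steps of size T / n; it tends to
      the exponential expression.\<close>
    let ?p = "\<lambda>n::nat. (R + \<epsilon>) * (((1 + \<Lambda> * T / n) ^ n - 1) / \<Lambda>)"
    have "?p \<longlonglongrightarrow> (R + \<epsilon>) * ((exp (\<Lambda> * T) - 1) / \<Lambda>)"
      by (intro tendsto_intros tendsto_exp_limit_sequentially \<Lambda>)
    moreover have "eventually (\<lambda>n. u t \<le> ?p n) sequentially"
    proof -
      have "(\<lambda>n. T / real n) \<longlonglongrightarrow> 0"
        by (rule lim_const_over_n)
      then have "eventually (\<lambda>n. T / real n < \<delta>\<^sub>0) sequentially"
        and "eventually (\<lambda>n. T / real n < 1 / \<bar>\<Lambda>\<bar>) sequentially"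
        using \<delta>\<^sub>0(1) \<Lambda> by (auto intro: order_tendstoD(2))
      then show ?thesis
        using eventually_gt_at_top[of 0]
      proof eventually_elim
        case (elim n)
        define \<delta> where "\<delta> = T / n"
        have \<delta>: "0 < \<delta>" "\<delta> < \<delta>\<^sub>0" "n * \<delta> = T"
          using elim T by (auto simp: \<delta>_def)
        have "\<delta> * \<bar>\<Lambda>\<bar> < 1"
          using elim(2) \<Lambda> by (simp add: \<delta>_def field_simps)
        moreover have "- (\<delta> * \<Lambda>) \<le> \<delta> * \<bar>\<Lambda>\<bar>"
          using \<delta>(1) by (simp add: abs_if)
        \<comment> \<open>A non-negative growth factor is what permits the induction hypothesis to
          be multiplied by it, also for negative \<Lambda>.\<close>
        ultimately have pos: "0 \<le> 1 + \<delta> * \<Lambda>" by linarith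
        \<comment> \<open>The recursion adds up the geometric series \<delta> (1 + \<delta>
          \<Lambda>)^i for i < j, whose closed form is the quotient on the right; the initial value
          only helps, since \<open>u a \<le> 0\<close>.\<close>
        have "u (a + j * \<delta>) \<le> (R + \<epsilon>) * (((1 + \<delta> * \<Lambda>) ^ j - 1) / \<Lambda>)" if "j \<le> n" for j :: nat
          using that
        proof (induction j)
          case 0
          then show ?case using ua by simp
        next
          case (Suc j)
          have "Suc j * \<delta> \<le> T"
            unfolding \<delta>(3)[symmetric] using Suc.prems \<delta>(1) by (intro mult_right_mono) auto
          then have le: "a + j * \<delta> + \<delta> \<le> b"
            using t by (simp add: T_def algebra_simps)
          have "u (a + Suc j * \<delta>) = u (a + j * \<delta> + \<delta>)"
            by (simp add: algebra_simps)
          also have "\<dots> \<le> (1 + \<delta> * \<Lambda>) * u (a + j * \<delta>) + \<delta> * (R + \<epsilon>)"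
            by (rule \<delta>\<^sub>0(2)) (use \<delta> le in auto)
          also have "\<dots> \<le> (1 + \<delta> * \<Lambda>) * ((R + \<epsilon>) * (((1 + \<delta> * \<Lambda>) ^ j - 1) / \<Lambda>)) + \<delta> * (R + \<epsilon>)"
            using Suc pos by (intro add_right_mono mult_left_mono) auto
          also have "\<dots> = (R + \<epsilon>) * (((1 + \<delta> * \<Lambda>) ^ Suc j - 1) / \<Lambda>)"
            using \<Lambda> by (simp add: field_simps)
          finally show ?case .
        qed
        from this[of n] show ?case
          by (simp add: \<delta>(3)) (simp add: T_def \<delta>_def mult.commute)
      qed
    qed
    ultimately show ?thesis
      by (rule tendsto_lowerbound) simp
  qed
  \<comment> \<open>The slack \<epsilon> of the step inequality is removed by letting it tend to 0
    from the right.\<close>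
  have "((\<lambda>\<epsilon>. (R + \<epsilon>) * ((exp (\<Lambda> * T) - 1) / \<Lambda>)) \<longlongrightarrow> (R + 0) * ((exp (\<Lambda> * T) - 1) / \<Lambda>)) (at_right 0)"
    by (intro tendsto_intros) (use \<Lambda> in auto)
  then have "u t \<le> (R + 0) * ((exp (\<Lambda> * T) - 1) / \<Lambda>)"
    by (rule tendsto_lowerbound) (auto intro!: eventually_at_rightI[of 0 1] bound[simplified])
  then show ?thesis by (simp add: T_def)
qed

text \<open>The quotient is the integral of exp (\<Lambda> \<sigma>) over \<sigma> from 0 to the
  endpoint, hence increasing for either sign of \<Lambda>.\<close>

lemma expm1_over_mono:
  fixes \<Lambda> :: real
  assumes "\<Lambda> \<noteq> 0" "s \<le> t"
  shows "(exp (\<Lambda> * s) - 1) / \<Lambda> \<le> (exp (\<Lambda> * t) - 1) / \<Lambda>"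
proof (cases "\<Lambda> > 0")
  case True
  then show ?thesis using assms by (intro divide_right_mono) auto
next
  case False
  then have "\<Lambda> < 0" using assms by simp
  then show ?thesis using assms by (intro divide_right_mono_neg) (auto simp: mult_left_mono_neg)
qed

section \<open>The integral equation on subintervals and in components\<close>

lemma is_sol_has_integral:
  assumes sol: "is_sol f g m u a b z" and st: "a \<le> s" "s \<le> t" "t \<le> b"
  shows "((\<lambda>s. f (z s) + (\<Sum>i\<in>{1..m}. u i s *\<^sub>R g i (z s))) has_integral (z t - z s)) {s..t}"
    (is "(?F has_integral _) _")
proof -
  have at: "(?F has_integral (z t - z a)) {a..t}" and as: "(?F has_integral (z s - z a)) {a..s}"
    using sol[unfolded is_sol_def, rule_format, of t] sol[unfolded is_sol_def, rule_format, of s] st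
    by simp_all
  have "?F integrable_on {s..t}"
    by (rule integrable_subinterval_real[OF has_integral_integrable[OF at]]) (use st in simp)
  then obtain I where I: "(?F has_integral I) {s..t}" by blast
  have "(?F has_integral (z s - z a + I)) {a..t}"
    by (rule has_integral_combine[OF st(1,2) as I])
  then have "z s - z a + I = z t - z a"
    using at by (rule has_integral_unique)
  then have "I = z t - z s" by (simp add: algebra_simps)
  with I show ?thesis by simp
qed

lemma has_integral_vec_nth:
  assumes "(F has_integral I) S"
  shows "((\<lambda>t. F t $ k) has_integral (I $ k)) S"
  using has_integral_linear[OF assms bounded_linear_vec_nth[of k]] by (simp add: o_def)

lemma has_integral_abs_le:
  fixes F :: "real \<Rightarrow> real"
  assumes "(F has_integral I) {s..t}" "s \<le> t" "\<And>\<tau>. \<tau> \<in> {s..t} \<Longrightarrow> \<bar>F \<tau>\<bar> \<le> C"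
  shows "\<bar>I\<bar> \<le> C * (t - s)"
proof -
  have "0 \<le> C" using assms(3)[of s] assms(2) by force
  with has_integral_bound_real[OF this finite.emptyI assms(1)] assms(2,3) show ?thesis by simp
qed

subsection \<open>Solutions of input-affine systems\<close>

text \<open>Non-emptiness of \<open>B\<close> makes the bounding constants non-negative, which the
  later estimates need when they multiply inequalities; the initial point \<open>x a\<close> will
  witness it.\<close>

locale bounded_system =
  fixes f :: "real^'n \<Rightarrow> real^'n" and g :: "nat \<Rightarrow> real^'n \<Rightarrow> real^'n" and m :: nat
    and B :: "(real^'n) set" and K L H \<Lambda> :: real and Ki Li :: "nat \<Rightarrow> real"
  assumes f_C2: "C2 f" and g_C2: "\<And>i. i \<in> {1..m} \<Longrightarrow> C2 (g i)" and B_convex: "convex B"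
    and bK: "\<And>z. z \<in> B \<Longrightarrow> mnorm (f z) \<le> K"
    and bKi: "\<And>i z. i \<in> {1..m} \<Longrightarrow> z \<in> B \<Longrightarrow> mnorm (g i z) \<le> Ki i"
    and bL: "\<And>z. z \<in> B \<Longrightarrow> mat_norm (Jac f z) \<le> L"
    and bLi: "\<And>i z. i \<in> {1..m} \<Longrightarrow> z \<in> B \<Longrightarrow> mat_norm (Jac (g i) z) \<le> Li i"
    and bH: "\<And>z. z \<in> B \<Longrightarrow> d2_norm f z \<le> H"
    and bLam: "\<And>z. z \<in> B \<Longrightarrow> log_norm (Jac f z) \<le> \<Lambda>"
    and B_nonempty: "B \<noteq> {}"
begin

lemma bounds_nonneg:
  shows K_nonneg: "0 \<le> K" and L_nonneg: "0 \<le> L" and H_nonneg: "0 \<le> H"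
    and Ki_nonneg: "i \<in> {1..m} \<Longrightarrow> 0 \<le> Ki i" and Li_nonneg: "i \<in> {1..m} \<Longrightarrow> 0 \<le> Li i"
proof -
  obtain z where z: "z \<in> B" using B_nonempty by blast
  show "0 \<le> K" "0 \<le> L" "i \<in> {1..m} \<Longrightarrow> 0 \<le> Ki i" "i \<in> {1..m} \<Longrightarrow> 0 \<le> Li i"
    by (rule order_trans[OF mnorm_nonneg bK[OF z]] order_trans[OF mat_norm_nonneg bL[OF z]]
        order_trans[OF mnorm_nonneg bKi[OF _ z]] order_trans[OF mat_norm_nonneg bLi[OF _ z]]; assumption)+
  show "0 \<le> H"
    using bH[OF z] d2_norm_nonneg[of f z] f_C2 by (auto simp: C2_def intro: order_trans)
qed

lemma Df_g_constant_nonneg: "i \<in> {1..m} \<Longrightarrow> 0 \<le> H * Ki i + L * Li i"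
  by (intro add_nonneg_nonneg mult_nonneg_nonneg bounds_nonneg)

lemma f_lipschitz: "p \<in> B \<Longrightarrow> q \<in> B \<Longrightarrow> mnorm (f p - f q) \<le> L * mnorm (p - q)"
  by (rule C2_lipschitz[OF f_C2 B_convex _ _ bL])

lemma g_lipschitz:
  "i \<in> {1..m} \<Longrightarrow> p \<in> B \<Longrightarrow> q \<in> B \<Longrightarrow> mnorm (g i p - g i q) \<le> Li i * mnorm (p - q)"
  by (rule C2_lipschitz[OF g_C2 B_convex _ _ bLi])

lemma Df_f_lipschitz:
  assumes "p \<in> B" "q \<in> B"
  shows "\<bar>(Jac f p *v f p) $ k - (Jac f q *v f q) $ k\<bar> \<le> (H * K + L\<^sup>2) * mnorm (p - q)"
  unfolding power2_eq_square
  by (rule C2_Jac_mult_lipschitz[OF f_C2 f_C2 B_convex assms bL bH bK bL L_nonneg H_nonneg])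

lemma Df_g_lipschitz:
  assumes "i \<in> {1..m}" "p \<in> B" "q \<in> B"
  shows "\<bar>(Jac f p *v g i p) $ k - (Jac f q *v g i q) $ k\<bar> \<le> (H * Ki i + L * Li i) * mnorm (p - q)"
  by (rule C2_Jac_mult_lipschitz[OF f_C2 g_C2 B_convex assms(2,3) bL bH bKi bLi L_nonneg H_nonneg])
    (use assms(1) in auto)

lemma sum_component_bound:
  assumes "z \<in> B" "\<And>i. i \<in> {1..m} \<Longrightarrow> \<bar>c i\<bar> \<le> U i"
  shows "\<bar>(\<Sum>i\<in>{1..m}. c i *\<^sub>R g i z) $ k\<bar> \<le> (\<Sum>i\<in>{1..m}. U i * Ki i)"
proof -
  have "\<bar>\<Sum>i\<in>{1..m}. c i * g i z $ k\<bar> \<le> (\<Sum>i\<in>{1..m}. U i * Ki i)"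
  proof (rule order_trans[OF sum_abs sum_mono], unfold abs_mult)
    fix i assume i: "i \<in> {1..m}"
    show "\<bar>c i\<bar> * \<bar>g i z $ k\<bar> \<le> U i * Ki i"
      using assms(2)[OF i] order_trans[OF component_le_mnorm[of _ k] bKi[OF i assms(1)]]
      by (intro mult_mono) auto
  qed
  then show ?thesis by simp
qed

lemma field_component_bound:
  assumes "z \<in> B" "\<And>i. i \<in> {1..m} \<Longrightarrow> \<bar>c i\<bar> \<le> U i"
  shows "\<bar>(f z + (\<Sum>i\<in>{1..m}. c i *\<^sub>R g i z)) $ k\<bar> \<le> K + (\<Sum>i\<in>{1..m}. U i * Ki i)"
  using sum_component_bound[of z c U k, OF assms] order_trans[OF component_le_mnorm[of _ k] bK[OF assms(1)]]
  unfolding vector_add_component by linarith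

context
  fixes u :: "nat \<Rightarrow> real \<Rightarrow> real" and U :: "nat \<Rightarrow> real" and a b :: real and z :: "real \<Rightarrow> real^'n"
  assumes sol: "is_sol f g m u a b z" and zB: "\<And>t. t \<in> {a..b} \<Longrightarrow> z t \<in> B"
    and uU: "\<And>i t. i \<in> {1..m} \<Longrightarrow> t \<in> {a..b} \<Longrightarrow> \<bar>u i t\<bar> \<le> U i"
begin

lemma solution_lipschitz:
  assumes s: "s \<in> {a..b}" and t: "t \<in> {a..b}"
  shows "mnorm (z t - z s) \<le> (K + (\<Sum>i\<in>{1..m}. U i * Ki i)) * \<bar>t - s\<bar>"
proof -
  have le: "mnorm (z t - z s) \<le> (K + (\<Sum>i\<in>{1..m}. U i * Ki i)) * (t - s)"
    if st: "s \<le> t" "s \<in> {a..b}" "t \<in> {a..b}" for s t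
  proof (rule mnorm_leI, rule has_integral_abs_le[OF has_integral_vec_nth[OF is_sol_has_integral[OF sol]]])
    fix \<tau> k assume "\<tau> \<in> {s..t}"
    then have "\<tau> \<in> {a..b}" using st by auto
    then show "\<bar>(f (z \<tau>) + (\<Sum>i\<in>{1..m}. u i \<tau> *\<^sub>R g i (z \<tau>))) $ k\<bar> \<le> K + (\<Sum>i\<in>{1..m}. U i * Ki i)"
      by (intro field_component_bound zB uU)
  qed (use st in auto)
  show ?thesis
    using le[of s t] le[of t s] s t by (cases "s \<le> t") (auto simp: mnorm_minus_commute)
qed

text \<open>Continuity and derivatives refer to the Euclidean norm, so the maximum-norm estimate is
  transferred at the price of a dimension factor.\<close>

lemma solution_norm_lipschitz:
  obtains C where "\<And>s t. s \<in> {a..b} \<Longrightarrow> t \<in> {a..b} \<Longrightarrow> norm (z t - z s) \<le> C * \<bar>t - s\<bar>"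
proof
  fix s t assume "s \<in> {a..b}" "t \<in> {a..b}"
  have "norm (z t - z s) \<le> sqrt DIM(real^'n) * mnorm (z t - z s)"
    unfolding mnorm_eq_infnorm by (rule norm_le_infnorm)
  also have "\<dots> \<le> sqrt DIM(real^'n) * ((K + (\<Sum>i\<in>{1..m}. U i * Ki i)) * \<bar>t - s\<bar>)"
    by (intro mult_left_mono solution_lipschitz \<open>s \<in> {a..b}\<close> \<open>t \<in> {a..b}\<close>) simp
  finally show "norm (z t - z s) \<le> (sqrt DIM(real^'n) * (K + (\<Sum>i\<in>{1..m}. U i * Ki i))) * \<bar>t - s\<bar>"
    by (simp add: mult.assoc)
qed

lemma solution_continuous: "continuous_on {a..b} z"
proof -
  obtain C where C: "\<And>s t. s \<in> {a..b} \<Longrightarrow> t \<in> {a..b} \<Longrightarrow> norm (z t - z s) \<le> C * \<bar>t - s\<bar>"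
    using solution_norm_lipschitz by blast
  have "\<bar>C\<bar>-lipschitz_on {a..b} z"
    unfolding lipschitz_on_def
  proof (intro conjI ballI)
    fix s t assume "s \<in> {a..b}" "t \<in> {a..b}"
    then have "norm (z s - z t) \<le> C * \<bar>s - t\<bar>" by (intro C)
    also have "\<dots> \<le> \<bar>C\<bar> * \<bar>s - t\<bar>" by (intro mult_right_mono) auto
    finally show "dist (z s) (z t) \<le> \<bar>C\<bar> * dist s t" by (simp add: dist_norm)
  qed simp
  then show ?thesis by (rule lipschitz_on_continuous_on)
qed

lemma C2_along_solution_continuous: "C2 q \<Longrightarrow> continuous_on {a..b} (\<lambda>t. q (z t))"
  using continuous_on_compose[OF solution_continuous C2_continuous_on] by (simp add: o_def)

lemma Df_along_solution_continuous:
  assumes "C2 q"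
  shows "continuous_on {a..b} (\<lambda>t. (Jac f (z t) *v q (z t)) $ k)"
  unfolding matrix_vector_mul_component
  using continuous_on_compose[OF solution_continuous C2_Jac_continuous_on[OF f_C2]]
    C2_along_solution_continuous[OF assms]
  by (auto intro!: continuous_intros simp: o_def)

context
  assumes u_meas: "\<And>i. i \<in> {1..m} \<Longrightarrow> u i \<in> borel_measurable (lebesgue_on {a..b})"
begin

text \<open>The controls are only measurable, but the velocity is linear in them: after expansion
  each bounded control multiplies a function that is continuous along the solution.\<close>

lemma weighted_Df_field_integrable:
  assumes "continuous_on {a..b} \<rho>"
  shows "(\<lambda>t. \<rho> t * (Jac f (z t) *v (f (z t) + (\<Sum>i\<in>{1..m}. u i t *\<^sub>R g i (z t)))) $ k) integrable_on {a..b}"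
proof -
  have "(\<lambda>t. \<rho> t * (Jac f (z t) *v f (z t)) $ k
      + (\<Sum>i\<in>{1..m}. u i t * (\<rho> t * (Jac f (z t) *v g i (z t)) $ k))) integrable_on {a..b}"
    by (intro integrable_add integrable_sum bounded_measurable_times_continuous_integrable[OF u_meas uU]
        integrable_continuous_real continuous_on_mult assms Df_along_solution_continuous f_C2 g_C2) auto
  then show ?thesis
    by (simp add: matrix_vector_right_distrib linear_sum[OF matrix_vector_mul_linear] matrix_vector_mult_scaleR
        sum_distrib_left algebra_simps)
qed

text \<open>The solution is only Lipschitz, so integration by parts is obtained by checking that the
  difference of both sides, as a function of the upper endpoint, has derivative zero
  \<^emph>\<open>everywhere\<close>: the non-differentiable increments of \<open>z\<close> cancel to first order.\<close>

lemma integral_f_by_parts: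
  assumes ab: "a \<le> b"
  shows "integral {a..b} (\<lambda>t. f (z t) $ k) = (b - c) * f (z b) $ k - (a - c) * f (z a) $ k
    - integral {a..b} (\<lambda>t. (t - c) * (Jac f (z t) *v (f (z t) + (\<Sum>i\<in>{1..m}. u i t *\<^sub>R g i (z t)))) $ k)"
proof -
  let ?F = "\<lambda>t. f (z t) + (\<Sum>i\<in>{1..m}. u i t *\<^sub>R g i (z t))"
  \<comment> \<open>Row \<open>k\<close> of the Jacobian times the weight, so that
    \<open>C t \<bullet> ?F t\<close> is formally (t - c) times the time derivative of
    \<open>f (z t) $ k\<close>.\<close>
  define C where "C = (\<lambda>t. (t - c) *\<^sub>R (Jac f (z t) $ k))"
  have CF: "C t \<bullet> ?F t = (t - c) * (Jac f (z t) *v ?F t) $ k" for t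
    by (simp add: C_def matrix_vector_mul_component)
  let ?Q = "\<lambda>\<tau>. (\<tau> - c) * f (z \<tau>) $ k - integral {a..\<tau>} (\<lambda>t. f (z t) $ k) - integral {a..\<tau>} (\<lambda>t. C t \<bullet> ?F t)"
  obtain M where M: "\<And>s t. s \<in> {a..b} \<Longrightarrow> t \<in> {a..b} \<Longrightarrow> norm (z t - z s) \<le> M * \<bar>t - s\<bar>"
    using solution_norm_lipschitz by blast
  have fc: "continuous_on {a..b} (\<lambda>t. f (z t) $ k)"
    by (intro continuous_intros C2_along_solution_continuous f_C2)
  have "(?Q has_real_derivative 0) (at t within {a..b})" if t: "t \<in> {a..b}" for t
  proof -
    have D1: "((\<lambda>\<tau>. integral {a..\<tau>} (\<lambda>\<sigma>. C \<sigma> \<bullet> ?F \<sigma>) - C t \<bullet> z \<tau>) has_real_derivative 0) (at t within {a..b})"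
    proof (rule indefinite_integral_tangent[OF _ _ _ _ t])
      show "(?F has_integral (z t - z a)) {a..t}" if "t \<in> {a..b}" for t
        using sol that by (simp add: is_sol_def)
      show "norm (?F t) \<le> sqrt DIM(real^'n) * (K + (\<Sum>i\<in>{1..m}. U i * Ki i))" if t: "t \<in> {a..b}" for t
      proof -
        have "mnorm (?F t) \<le> K + (\<Sum>i\<in>{1..m}. U i * Ki i)"
          by (intro mnorm_leI field_component_bound zB uU t)
        then have "sqrt DIM(real^'n) * mnorm (?F t) \<le> sqrt DIM(real^'n) * (K + (\<Sum>i\<in>{1..m}. U i * Ki i))"
          by (intro mult_left_mono) auto
        then show ?thesis
          using norm_le_infnorm[of "?F t"] unfolding mnorm_eq_infnorm by linarith
      qed
      show "continuous_on {a..b} C"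
        unfolding C_def
        using continuous_on_compose[OF solution_continuous C2_Jac_continuous_on[OF f_C2]]
        by (auto intro!: continuous_intros simp: o_def)
      show "(\<lambda>t. C t \<bullet> ?F t) integrable_on {a..b}"
        unfolding CF by (intro weighted_Df_field_integrable continuous_intros)
    qed
    have "((\<lambda>q. f q $ k - Jac f (z t) $ k \<bullet> q) has_derivative
        (\<lambda>r. (Jac f (z t) *v r) $ k - Jac f (z t) $ k \<bullet> r)) (at (z t))"
      by (intro has_derivative_diff C2_component_has_derivative f_C2 has_derivative_inner_right has_derivative_ident)
    then have D2: "((\<lambda>\<tau>. f (z \<tau>) $ k - Jac f (z t) $ k \<bullet> z \<tau>) has_real_derivative 0) (at t within {a..b})"
      by (intro has_derivative_zero_compose_lipschitz[where x = z and C = M and r = "\<lambda>q. f q $ k - Jac f (z t) $ k \<bullet> q"] M t)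
        (simp_all add: matrix_vector_mul_component)
    \<comment> \<open>The factor \<tau> - t vanishes at \<open>t\<close>, so the difference quotient
      is \<open>f (z \<tau>) $ k\<close> itself and continuity suffices.\<close>
    have D3: "((\<lambda>\<tau>. (\<tau> - t) * f (z \<tau>) $ k) has_real_derivative f (z t) $ k) (at t within {a..b})"
    proof -
      have "((\<lambda>\<tau>. f (z \<tau>) $ k) \<longlongrightarrow> f (z t) $ k) (at t within {a..b})"
        using fc t by (auto simp: continuous_on_def)
      then show ?thesis
        unfolding has_field_derivative_iff
        by (rule Lim_transform_eventually) (auto simp: eventually_at_filter)
    qed
    have D4: "((\<lambda>\<tau>. integral {a..\<tau>} (\<lambda>t. f (z t) $ k)) has_real_derivative f (z t) $ k) (at t within {a..b})"
      by (rule integral_has_real_derivative[OF fc t])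
    \<comment> \<open>\<open>?Q\<close> is rewritten with \<tau> - c = (\<tau> - t) + (t - c), and
      \<open>C t \<bullet> z \<tau>\<close> is subtracted once and added once. Each remaining
      summand has a known derivative at \<open>t\<close>, and the two copies of
      \<open>f (z t) $ k\<close> cancel.\<close>
    have "((\<lambda>\<tau>. (\<tau> - t) * f (z \<tau>) $ k + (t - c) * (f (z \<tau>) $ k - Jac f (z t) $ k \<bullet> z \<tau>)
        - integral {a..\<tau>} (\<lambda>t. f (z t) $ k)
        - (integral {a..\<tau>} (\<lambda>\<sigma>. C \<sigma> \<bullet> ?F \<sigma>) - C t \<bullet> z \<tau>))
        has_real_derivative (f (z t) $ k + (t - c) * 0 - f (z t) $ k - 0)) (at t within {a..b})"
      by (intro DERIV_diff DERIV_add DERIV_cmult D1 D2 D3 D4)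
    moreover have "(\<lambda>\<tau>. (\<tau> - t) * f (z \<tau>) $ k + (t - c) * (f (z \<tau>) $ k - Jac f (z t) $ k \<bullet> z \<tau>)
        - integral {a..\<tau>} (\<lambda>t. f (z t) $ k)
        - (integral {a..\<tau>} (\<lambda>\<sigma>. C \<sigma> \<bullet> ?F \<sigma>) - C t \<bullet> z \<tau>)) = ?Q"
      by (rule ext) (simp add: C_def algebra_simps)
    ultimately show ?thesis by simp
  qed
  from has_field_derivative_zero_constant[OF convex_real_interval(5) this]
  have "?Q b = ?Q a" using ab by force
  then show ?thesis unfolding CF by simp
qed

end
end
end

subsection \<open>Comparison of two solutions\<close>

locale matched_controls = bounded_system f g m B K L H \<Lambda> Ki Li
  for f :: "real^'n \<Rightarrow> real^'n" and g m B K L H \<Lambda> Ki Li +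
  fixes a b :: real and x y :: "real \<Rightarrow> real^'n" and v w :: "nat \<Rightarrow> real \<Rightarrow> real" and V W :: "nat \<Rightarrow> real"
  assumes ab: "a < b"
    and v_meas: "\<And>i. i \<in> {1..m} \<Longrightarrow> v i \<in> borel_measurable (lebesgue_on {a..b})"
    and v_le: "\<And>i t. i \<in> {1..m} \<Longrightarrow> t \<in> {a..b} \<Longrightarrow> \<bar>v i t\<bar> \<le> V i"
    and w_meas: "\<And>i. i \<in> {1..m} \<Longrightarrow> w i \<in> borel_measurable (lebesgue_on {a..b})"
    and w_le: "\<And>i t. i \<in> {1..m} \<Longrightarrow> t \<in> {a..b} \<Longrightarrow> \<bar>w i t\<bar> \<le> W i"
    and x_sol: "is_sol f g m v a b x" and y_sol: "is_sol f g m w a b y" and start: "y a = x a"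
    and xB: "\<And>t. t \<in> {a..b} \<Longrightarrow> x t \<in> B" and yB: "\<And>t. t \<in> {a..b} \<Longrightarrow> y t \<in> B"
    and mom0: "\<And>i. i \<in> {1..m} \<Longrightarrow> integral {a..b} (\<lambda>t. v i t - w i t) = 0"
begin

text \<open>\<open>KV\<close> is the constant \<open>K'\<close> of the theorem and \<open>KW\<close>
  its counterpart for the bounds on \<open>w\<close>; thus \<open>K + KV\<close> and
  \<open>K + KW\<close> bound the speeds of \<open>x\<close> and \<open>y\<close>.\<close>

definition "KV = (\<Sum>i\<in>{1..m}. V i * Ki i)"
definition "KW = (\<Sum>i\<in>{1..m}. W i * Ki i)"
abbreviation "c \<equiv> (a + b) / 2"

lemma V_nonneg: "i \<in> {1..m} \<Longrightarrow> 0 \<le> V i"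
  using v_le[of i a] ab by force

lemma W_nonneg: "i \<in> {1..m} \<Longrightarrow> 0 \<le> W i"
  using w_le[of i a] ab by force

lemma KV_nonneg: "0 \<le> KV" and KW_nonneg: "0 \<le> KW"
  unfolding KV_def KW_def using V_nonneg W_nonneg Ki_nonneg by (auto intro!: sum_nonneg)

lemma c_mem: "c \<in> {a..b}"
  using ab by auto

lemmas x_lip = solution_lipschitz[OF x_sol xB v_le, folded KV_def]
lemmas y_lip = solution_lipschitz[OF y_sol yB w_le, folded KW_def]
lemmas x_cont = C2_along_solution_continuous[OF x_sol xB v_le]
lemmas y_cont = C2_along_solution_continuous[OF y_sol yB w_le]
lemmas Df_x_cont = Df_along_solution_continuous[OF x_sol xB v_le]
lemmas Df_y_cont = Df_along_solution_continuous[OF y_sol yB w_le]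

lemma d_meas: "i \<in> {1..m} \<Longrightarrow> (\<lambda>t. v i t - w i t) \<in> borel_measurable (lebesgue_on {a..b})"
  by (intro borel_measurable_diff v_meas w_meas)

lemma d_le: "i \<in> {1..m} \<Longrightarrow> t \<in> {a..b} \<Longrightarrow> \<bar>v i t - w i t\<bar> \<le> V i + W i"
  using v_le[of i t] w_le[of i t] by linarith

lemmas d_integrable = bounded_measurable_times_continuous_integrable[OF d_meas d_le]
lemmas w_integrable = bounded_measurable_times_continuous_integrable[OF w_meas w_le]

lemma abs_w_integrable:
  "i \<in> {1..m} \<Longrightarrow> continuous_on {a..b} \<rho> \<Longrightarrow> (\<lambda>t. \<bar>w i t\<bar> * \<rho> t) integrable_on {a..b}"
  by (rule bounded_measurable_times_continuous_integrable[where U = "W i"])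
    (auto intro!: borel_measurable_abs w_meas w_le)

lemma abs_d_integrable:
  "i \<in> {1..m} \<Longrightarrow> continuous_on {a..b} \<rho> \<Longrightarrow> (\<lambda>t. \<bar>v i t - w i t\<bar> * \<rho> t) integrable_on {a..b}"
  by (rule bounded_measurable_times_continuous_integrable[where U = "V i + W i"])
    (auto intro!: borel_measurable_abs d_meas d_le)

text \<open>Both curves leave the same point with bounded speed.\<close>

lemma error_linear:
  assumes t: "t \<in> {a..b}"
  shows "mnorm (x t - y t) \<le> (2 * K + KV + KW) * (t - a)"
proof -
  have "x t - y t = (x t - x a) + (y a - y t)" by (simp add: start)
  then have "mnorm (x t - y t) \<le> mnorm (x t - x a) + mnorm (y a - y t)"
    by (metis mnorm_triangle)
  also have "mnorm (x t - x a) \<le> (K + KV) * \<bar>t - a\<bar>"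
    by (rule x_lip) (use t ab in auto)
  also have "mnorm (y a - y t) \<le> (K + KW) * \<bar>a - t\<bar>"
    by (rule y_lip) (use t ab in auto)
  finally show ?thesis using t by (simp add: algebra_simps)
qed

text \<open>Over a short step the error is the Euler image of its value at the start of the step,
  controlled by the logarithmic norm, plus a contribution of the controls of at most
  \<open>KV + KW\<close> per unit time. The control terms are treated purely as a bounded
  inhomogeneity, so only the Jacobian of \<open>f\<close> enters the exponent.\<close>

lemma error_gronwall:
  assumes \<Lambda>: "\<Lambda> \<noteq> 0" and t: "t \<in> {a..b}"
  shows "mnorm (x t - y t) \<le> (KV + KW) * ((exp (\<Lambda> * (t - a)) - 1) / \<Lambda>)"
proof (rule gronwall_one_sided[OF \<Lambda> _ t])
  show "mnorm (x a - y a) \<le> 0" by (simp add: start)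
  fix \<epsilon> :: real assume \<epsilon>: "\<epsilon> > 0"
  \<comment> \<open>Freezing \<open>f\<close> at the start of a step of size \<delta> costs at most
    \<open>M * \<delta>\<close> for both curves together. In \<open>\<delta>\<^sub>0\<close> the
    first entry gives \<open>\<delta> * L \<le> 1\<close>, as the Euler bound demands, and the
    second makes this cost at most \<epsilon>; each summand 1 keeps the denominator
    positive.\<close>
  define M where "M = L * ((K + KV) + (K + KW))"
  have M: "0 \<le> M"
    unfolding M_def using K_nonneg L_nonneg KV_nonneg KW_nonneg by simp
  define \<delta>\<^sub>0 where "\<delta>\<^sub>0 = min (1 / (L + 1)) (\<epsilon> / (M + 1))"
  show "\<exists>\<delta>\<^sub>0>0. \<forall>s \<delta>. a \<le> s \<and> 0 < \<delta> \<and> \<delta> < \<delta>\<^sub>0 \<and> s + \<delta> \<le> b \<longrightarrow>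
      mnorm (x (s + \<delta>) - y (s + \<delta>)) \<le> (1 + \<delta> * \<Lambda>) * mnorm (x s - y s) + \<delta> * (KV + KW + \<epsilon>)"
  proof (intro exI[of _ \<delta>\<^sub>0] conjI allI impI)
    show "\<delta>\<^sub>0 > 0" using \<epsilon> M L_nonneg by (simp add: \<delta>\<^sub>0_def)
    fix s \<delta> assume "a \<le> s \<and> 0 < \<delta> \<and> \<delta> < \<delta>\<^sub>0 \<and> s + \<delta> \<le> b"
    then have s: "a \<le> s" "s + \<delta> \<le> b" and \<delta>: "0 < \<delta>" "\<delta> < 1 / (L + 1)" "\<delta> < \<epsilon> / (M + 1)"
      by (auto simp: \<delta>\<^sub>0_def)
    have sm: "s \<in> {a..b}" using s \<delta> by auto
    have "\<delta> * (L + 1) < 1" "\<delta> * (M + 1) < \<epsilon>"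
      using \<delta> L_nonneg M by (simp_all add: pos_less_divide_eq)
    then have \<delta>L: "\<delta> * L \<le> 1" and \<delta>M: "M * \<delta> \<le> \<epsilon>"
      using \<delta>(1) by (simp_all add: algebra_simps)
    show "mnorm (x (s + \<delta>) - y (s + \<delta>)) \<le> (1 + \<delta> * \<Lambda>) * mnorm (x s - y s) + \<delta> * (KV + KW + \<epsilon>)"
    proof (rule mnorm_leI)
      fix k
      let ?G = "\<lambda>\<tau>. (f (x \<tau>) + (\<Sum>i\<in>{1..m}. v i \<tau> *\<^sub>R g i (x \<tau>))) - (f (y \<tau>) + (\<Sum>i\<in>{1..m}. w i \<tau> *\<^sub>R g i (y \<tau>)))"
      let ?r = "f (x s) $ k - f (y s) $ k"
      let ?I = "(x (s + \<delta>) - x s - (y (s + \<delta>) - y s)) $ k"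
      have "(?G has_integral (x (s + \<delta>) - x s - (y (s + \<delta>) - y s))) {s..s + \<delta>}"
        by (intro has_integral_diff is_sol_has_integral[OF x_sol] is_sol_has_integral[OF y_sol])
          (use s \<delta> in auto)
      from has_integral_vec_nth[OF this, of k]
      have "((\<lambda>\<tau>. ?G \<tau> $ k - ?r) has_integral (?I - (s + \<delta> - s) *\<^sub>R ?r)) {s..s + \<delta>}"
        using has_integral_const_real[of ?r s "s + \<delta>"] \<delta>(1) by (intro has_integral_diff) simp_all
      then have "\<bar>?I - (s + \<delta> - s) *\<^sub>R ?r\<bar> \<le> (KV + KW + \<epsilon>) * (s + \<delta> - s)"
      proof (rule has_integral_abs_le)
        fix \<tau> assume \<tau>: "\<tau> \<in> {s..s + \<delta>}"
        then have \<tau>m: "\<tau> \<in> {a..b}" using s by auto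
        have le: "\<bar>f (z \<tau>) $ k - f (z s) $ k\<bar> \<le> L * (C * \<delta>)"
          if z: "z \<tau> \<in> B" "z s \<in> B" "mnorm (z \<tau> - z s) \<le> C * \<bar>\<tau> - s\<bar>" and C: "0 \<le> C"
          for z :: "real \<Rightarrow> real^'n" and C
        proof -
          have "\<bar>(f (z \<tau>) - f (z s)) $ k\<bar> \<le> L * mnorm (z \<tau> - z s)"
            by (rule order_trans[OF component_le_mnorm f_lipschitz[OF z(1,2)]])
          also have "\<dots> \<le> L * (C * \<bar>\<tau> - s\<bar>)"
            by (intro mult_left_mono z L_nonneg)
          also have "\<dots> \<le> L * (C * \<delta>)"
            using \<tau> C L_nonneg by (intro mult_left_mono) auto
          finally show ?thesis by simp
        qed
        have 1: "\<bar>f (x \<tau>) $ k - f (x s) $ k\<bar> \<le> L * ((K + KV) * \<delta>)"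
          by (intro le xB \<tau>m sm x_lip add_nonneg_nonneg K_nonneg KV_nonneg)
        have 2: "\<bar>f (y \<tau>) $ k - f (y s) $ k\<bar> \<le> L * ((K + KW) * \<delta>)"
          by (intro le yB \<tau>m sm y_lip add_nonneg_nonneg K_nonneg KW_nonneg)
        have 3: "\<bar>(\<Sum>i\<in>{1..m}. v i \<tau> *\<^sub>R g i (x \<tau>)) $ k\<bar> \<le> KV"
          unfolding KV_def by (intro sum_component_bound xB v_le \<tau>m)
        have 4: "\<bar>(\<Sum>i\<in>{1..m}. w i \<tau> *\<^sub>R g i (y \<tau>)) $ k\<bar> \<le> KW"
          unfolding KW_def by (intro sum_component_bound yB w_le \<tau>m)
        have "L * ((K + KV) * \<delta>) + L * ((K + KW) * \<delta>) \<le> \<epsilon>"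
          using \<delta>M by (simp add: M_def algebra_simps)
        with 1 2 3 4 show "\<bar>?G \<tau> $ k - ?r\<bar> \<le> KV + KW + \<epsilon>"
          unfolding vector_minus_component vector_add_component by linarith
      qed (use \<delta> in auto)
      then have I: "\<bar>?I - \<delta> * ?r\<bar> \<le> (KV + KW + \<epsilon>) * \<delta>" by simp
      have der: "((\<lambda>q. q $ k + \<delta> * f q $ k) has_derivative (\<lambda>r. r $ k + \<delta> * (Jac f q *v r) $ k)) (at q)" for q
        by (intro has_derivative_add has_derivative_mult_right C2_component_has_derivative f_C2
            bounded_linear_imp_has_derivative bounded_linear_vec_nth)
      \<comment> \<open>The mean value theorem is applied to the component of the whole Euler map
        rather than to \<open>f\<close> alone, so that the identity and the Jacobian appear in one
        matrix row and the sign of the diagonal entry is retained.\<close>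
      obtain q where q: "q \<in> B" "(x s $ k + \<delta> * f (x s) $ k) - (y s $ k + \<delta> * f (y s) $ k)
          = (x s - y s) $ k + \<delta> * (Jac f q *v (x s - y s)) $ k"
        by (rule mvt_segment[OF B_convex xB[OF sm] yB[OF sm] der])
      have "\<delta> * mat_norm (Jac f q) \<le> 1"
        using \<delta>L mult_left_mono[OF bL[OF q(1)], of \<delta>] \<delta>(1) by linarith
      then have "\<bar>(x s - y s) $ k + \<delta> * (Jac f q *v (x s - y s)) $ k\<bar>
          \<le> (1 + \<delta> * log_norm (Jac f q)) * mnorm (x s - y s)"
        using \<delta>(1) by (intro abs_euler_component_le) auto
      also have "\<dots> \<le> (1 + \<delta> * \<Lambda>) * mnorm (x s - y s)"
        using bLam[OF q(1)] \<delta>(1) by (intro mult_right_mono add_left_mono mult_left_mono mnorm_nonneg) auto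
      finally have E: "\<bar>(x s - y s) $ k + \<delta> * ?r\<bar> \<le> (1 + \<delta> * \<Lambda>) * mnorm (x s - y s)"
        using q(2) by (simp add: algebra_simps)
      have "(x (s + \<delta>) - y (s + \<delta>)) $ k = ((x s - y s) $ k + \<delta> * ?r) + (?I - \<delta> * ?r)"
        by simp
      also have "\<bar>\<dots>\<bar> \<le> (1 + \<delta> * \<Lambda>) * mnorm (x s - y s) + (KV + KW + \<epsilon>) * \<delta>"
        by (rule order_trans[OF abs_triangle_ineq add_mono[OF E I]])
      finally show "\<bar>(x (s + \<delta>) - y (s + \<delta>)) $ k\<bar>
          \<le> (1 + \<delta> * \<Lambda>) * mnorm (x s - y s) + \<delta> * (KV + KW + \<epsilon>)"
        by (simp add: mult.commute)
    qed
  qed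
qed

text \<open>The control terms are split as v g(x) - w g(y) = (v - w) g(x) + w (g(x) - g(y)): the
  first part is accessible to the moment conditions, the second to bounds on the error.\<close>

lemma error_component:
  "(x b - y b) $ k = integral {a..b} (\<lambda>t. f (x t) $ k - f (y t) $ k)
    + (\<Sum>i\<in>{1..m}. integral {a..b} (\<lambda>t. (v i t - w i t) * g i (x t) $ k)
        + integral {a..b} (\<lambda>t. w i t * (g i (x t) $ k - g i (y t) $ k)))"
proof -
  have ag: "continuous_on {a..b} (\<lambda>t. g i (x t) $ k)" "continuous_on {a..b} (\<lambda>t. g i (y t) $ k)"
    if "i \<in> {1..m}" for i
    using that by (auto intro!: continuous_intros x_cont y_cont g_C2)
  have af: "(\<lambda>t. f (x t) $ k - f (y t) $ k) integrable_on {a..b}"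
    by (intro integrable_continuous_real continuous_intros x_cont y_cont f_C2)
  let ?P = "\<lambda>i t. (v i t - w i t) * g i (x t) $ k + w i t * (g i (x t) $ k - g i (y t) $ k)"
  have sol: "((\<lambda>t. (f (x t) + (\<Sum>i\<in>{1..m}. v i t *\<^sub>R g i (x t))) - (f (y t) + (\<Sum>i\<in>{1..m}. w i t *\<^sub>R g i (y t))))
      has_integral (x b - x a - (y b - y a))) {a..b}"
    by (intro has_integral_diff is_sol_has_integral[OF x_sol] is_sol_has_integral[OF y_sol])
      (use ab in auto)
  have Pi: "?P i integrable_on {a..b}" if "i \<in> {1..m}" for i
    using that by (intro integrable_add d_integrable w_integrable continuous_on_diff ag)
  have "((\<lambda>t. f (x t) $ k - f (y t) $ k + (\<Sum>i\<in>{1..m}. ?P i t)) has_integral (x b - x a - (y b - y a)) $ k) {a..b}"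
    using has_integral_vec_nth[OF sol, of k]
    by (rule has_integral_eq[rotated]) (simp add: sum.distrib[symmetric] sum_subtractf[symmetric] algebra_simps)
  then have "(x b - y b) $ k = integral {a..b} (\<lambda>t. f (x t) $ k - f (y t) $ k + (\<Sum>i\<in>{1..m}. ?P i t))"
    by (simp add: integral_unique start)
  also have "\<dots> = integral {a..b} (\<lambda>t. f (x t) $ k - f (y t) $ k) + (\<Sum>i\<in>{1..m}. integral {a..b} (?P i))"
    by (simp only: integral_add[OF af integrable_sum[OF finite_atLeastAtMost Pi]]
        integral_sum[OF finite_atLeastAtMost Pi])
  also have "(\<Sum>i\<in>{1..m}. integral {a..b} (?P i))
      = (\<Sum>i\<in>{1..m}. integral {a..b} (\<lambda>t. (v i t - w i t) * g i (x t) $ k)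
        + integral {a..b} (\<lambda>t. w i t * (g i (x t) $ k - g i (y t) $ k)))"
    by (intro sum.cong refl integral_add d_integrable w_integrable continuous_on_diff ag)
  finally show ?thesis .
qed

text \<open>The mean condition allows \<open>g i (x c)\<close> to be subtracted in the first
  integral; in the second the error is at most linear in t - a. The weighted integrals of the
  absolute controls are kept, since they are later bounded by suprema in the quadratic estimate and
  through square integrals in the affine case.\<close>

lemma control_error_le:
  assumes i: "i \<in> {1..m}"
  shows "\<bar>integral {a..b} (\<lambda>t. (v i t - w i t) * g i (x t) $ k)
        + integral {a..b} (\<lambda>t. w i t * (g i (x t) $ k - g i (y t) $ k))\<bar>
    \<le> Li i * ((K + KV) * integral {a..b} (\<lambda>t. \<bar>v i t - w i t\<bar> * \<bar>t - c\<bar>)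
      + (2 * K + KV + KW) * integral {a..b} (\<lambda>t. \<bar>w i t\<bar> * (t - a)))"
proof -
  have gc: "continuous_on {a..b} (\<lambda>t. g i (x t) $ k)" "continuous_on {a..b} (\<lambda>t. g i (y t) $ k)"
    using i by (auto intro!: continuous_intros x_cont y_cont g_C2)
  have "\<bar>integral {a..b} (\<lambda>t. (v i t - w i t) * (1 * g i (x t) $ k))\<bar>
      \<le> (Li i * (K + KV)) * integral {a..b} (\<lambda>t. \<bar>v i t - w i t\<bar> * (\<bar>1\<bar> * \<bar>t - c\<bar>))"
  proof (rule abs_integral_centered_le[OF d_meas[OF i] d_le[OF i] continuous_on_const gc(1)])
    fix t assume t: "t \<in> {a..b}"
    have "\<bar>(g i (x t) - g i (x c)) $ k\<bar> \<le> Li i * mnorm (x t - x c)"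
      by (rule order_trans[OF component_le_mnorm g_lipschitz[OF i xB[OF t] xB[OF c_mem]]])
    also have "\<dots> \<le> Li i * ((K + KV) * \<bar>t - c\<bar>)"
      by (intro mult_left_mono x_lip c_mem t Li_nonneg i)
    finally show "\<bar>g i (x t) $ k - g i (x c) $ k\<bar> \<le> Li i * (K + KV) * \<bar>t - c\<bar>"
      by (simp add: mult.assoc)
  qed (simp_all add: mom0[OF i])
  moreover have "norm (integral {a..b} (\<lambda>t. w i t * (g i (x t) $ k - g i (y t) $ k)))
      \<le> integral {a..b} (\<lambda>t. (Li i * (2 * K + KV + KW)) * (\<bar>w i t\<bar> * (t - a)))"
  proof (rule integral_norm_bound_integral)
    show "(\<lambda>t. w i t * (g i (x t) $ k - g i (y t) $ k)) integrable_on {a..b}"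
      by (intro w_integrable i continuous_on_diff gc)
    show "(\<lambda>t. (Li i * (2 * K + KV + KW)) * (\<bar>w i t\<bar> * (t - a))) integrable_on {a..b}"
      by (intro integrable_on_mult_right abs_w_integrable i continuous_intros)
    fix t assume t: "t \<in> {a..b}"
    have "\<bar>(g i (x t) - g i (y t)) $ k\<bar> \<le> Li i * mnorm (x t - y t)"
      by (rule order_trans[OF component_le_mnorm g_lipschitz[OF i xB[OF t] yB[OF t]]])
    also have "\<dots> \<le> Li i * ((2 * K + KV + KW) * (t - a))"
      by (intro mult_left_mono error_linear t Li_nonneg i)
    finally have "\<bar>w i t\<bar> * \<bar>g i (x t) $ k - g i (y t) $ k\<bar> \<le> \<bar>w i t\<bar> * (Li i * ((2 * K + KV + KW) * (t - a)))"
      by (intro mult_left_mono) auto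
    then show "norm (w i t * (g i (x t) $ k - g i (y t) $ k)) \<le> (Li i * (2 * K + KV + KW)) * (\<bar>w i t\<bar> * (t - a))"
      by (simp add: abs_mult mult_ac)
  qed
  moreover have "\<bar>p + q\<bar> \<le> l * (r * I + r' * I')"
    if "\<bar>p\<bar> \<le> (l * r) * I" "\<bar>q\<bar> \<le> (l * r') * I'" for p q l r r' I I' :: real
    using that by (simp add: distrib_left mult.assoc)
  ultimately show ?thesis by simp
qed

text \<open>Every integrand is of order b - a and is integrated over length b - a. The coefficient
  contains only the standing bounds, hence is uniform in the step, the controls and the
  solutions.\<close>

theorem local_error_quadratic:
  "mnorm (x b - y b) \<le> (L * (2 * K + KV + KW)
    + (\<Sum>i\<in>{1..m}. Li i * ((K + KV) * (V i + W i) + (2 * K + KV + KW) * W i))) * (b - a)\<^sup>2"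
proof (rule mnorm_leI)
  fix k
  let ?h = "b - a" and ?R = "2 * K + KV + KW"
  have h: "0 \<le> ?h" using ab by simp
  have R: "0 \<le> ?R" using K_nonneg KV_nonneg KW_nonneg by simp
  have F: "\<bar>integral {a..b} (\<lambda>t. f (x t) $ k - f (y t) $ k)\<bar> \<le> (L * (?R * ?h)) * ?h"
  proof (rule has_integral_abs_le[OF integrable_integral])
    show "(\<lambda>t. f (x t) $ k - f (y t) $ k) integrable_on {a..b}"
      by (intro integrable_continuous_real continuous_intros x_cont y_cont f_C2)
    fix t assume t: "t \<in> {a..b}"
    have "\<bar>(f (x t) - f (y t)) $ k\<bar> \<le> L * mnorm (x t - y t)"
      by (rule order_trans[OF component_le_mnorm f_lipschitz[OF xB[OF t] yB[OF t]]])
    also have "\<dots> \<le> L * (?R * (t - a))"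
      by (intro mult_left_mono error_linear t L_nonneg)
    also have "\<dots> \<le> L * (?R * ?h)"
      using t R L_nonneg by (intro mult_left_mono) auto
    finally show "\<bar>f (x t) $ k - f (y t) $ k\<bar> \<le> L * (?R * ?h)" by simp
  qed (use ab in simp)
  have G: "\<bar>integral {a..b} (\<lambda>t. (v i t - w i t) * g i (x t) $ k)
        + integral {a..b} (\<lambda>t. w i t * (g i (x t) $ k - g i (y t) $ k))\<bar>
    \<le> Li i * ((K + KV) * (V i + W i) + ?R * W i) * ?h\<^sup>2" if i: "i \<in> {1..m}" for i
  proof -
    have "\<bar>integral {a..b} (\<lambda>t. \<bar>v i t - w i t\<bar> * \<bar>t - c\<bar>)\<bar> \<le> ((V i + W i) * ?h) * ?h"
    proof (rule has_integral_abs_le[OF integrable_integral])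
      show "(\<lambda>t. \<bar>v i t - w i t\<bar> * \<bar>t - c\<bar>) integrable_on {a..b}"
        by (intro abs_d_integrable i continuous_intros)
      fix t assume t: "t \<in> {a..b}"
      then have "\<bar>t - c\<bar> \<le> ?h" by (auto simp: abs_if field_simps)
      then show "\<bar>\<bar>v i t - w i t\<bar> * \<bar>t - c\<bar>\<bar> \<le> (V i + W i) * ?h"
        using d_le[OF i t] V_nonneg[OF i] W_nonneg[OF i] by (simp add: abs_mult) (intro mult_mono; simp)
    qed (use ab in simp)
    moreover have "\<bar>integral {a..b} (\<lambda>t. \<bar>w i t\<bar> * (t - a))\<bar> \<le> (W i * ?h) * ?h"
    proof (rule has_integral_abs_le[OF integrable_integral])
      show "(\<lambda>t. \<bar>w i t\<bar> * (t - a)) integrable_on {a..b}"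
        by (intro abs_w_integrable i continuous_intros)
      fix t assume t: "t \<in> {a..b}"
      then show "\<bar>\<bar>w i t\<bar> * (t - a)\<bar> \<le> W i * ?h"
        using w_le[OF i t] W_nonneg[OF i] by (simp add: abs_mult) (intro mult_mono; simp)
    qed (use ab in simp)
    ultimately have "Li i * ((K + KV) * integral {a..b} (\<lambda>t. \<bar>v i t - w i t\<bar> * \<bar>t - c\<bar>)
        + ?R * integral {a..b} (\<lambda>t. \<bar>w i t\<bar> * (t - a)))
      \<le> Li i * ((K + KV) * (((V i + W i) * ?h) * ?h) + ?R * ((W i * ?h) * ?h))"
      using K_nonneg KV_nonneg R Li_nonneg[OF i] by (intro mult_left_mono add_mono) auto
    also have "\<dots> = Li i * ((K + KV) * (V i + W i) + ?R * W i) * ?h\<^sup>2"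
      by (simp add: power2_eq_square algebra_simps)
    finally show ?thesis using control_error_le[OF i, of k] by linarith
  qed
  have "\<bar>\<Sum>i\<in>{1..m}. integral {a..b} (\<lambda>t. (v i t - w i t) * g i (x t) $ k)
        + integral {a..b} (\<lambda>t. w i t * (g i (x t) $ k - g i (y t) $ k))\<bar>
    \<le> (\<Sum>i\<in>{1..m}. Li i * ((K + KV) * (V i + W i) + ?R * W i)) * ?h\<^sup>2"
    unfolding sum_distrib_right by (intro order_trans[OF sum_abs sum_mono] G)
  moreover have "\<bar>p + q\<bar> \<le> (l * r + S) * h\<^sup>2"
    if "\<bar>p\<bar> \<le> (l * (r * h)) * h" "\<bar>q\<bar> \<le> S * h\<^sup>2" for p q l r h S :: real
    using that by (simp add: power2_eq_square algebra_simps)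
  ultimately show "\<bar>(x b - y b) $ k\<bar> \<le> (L * ?R
    + (\<Sum>i\<in>{1..m}. Li i * ((K + KV) * (V i + W i) + ?R * W i))) * ?h\<^sup>2"
    unfolding error_component using F by blast
qed

text \<open>Integration by parts against t - c yields three contributions: a boundary term at
  \<open>b\<close>, to be absorbed into the left-hand side later; a Lipschitz difference between the
  two curves, bounded by the error bound \<open>M\<close> and the integral (b - a)^2 / 4 of |t - c|;
  and terms with \<open>v i - w i\<close>, where the first-moment condition gains a further factor
  |t - c|.\<close>

lemma drift_error_le:
  assumes mom1: "\<And>i. i \<in> {1..m} \<Longrightarrow> integral {a..b} (\<lambda>t. (t - c) * (v i t - w i t)) = 0"
    and M: "\<And>t. t \<in> {a..b} \<Longrightarrow> mnorm (x t - y t) \<le> M"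
  shows "\<bar>integral {a..b} (\<lambda>t. f (x t) $ k - f (y t) $ k)\<bar>
    \<le> L * ((b - a) / 2) * mnorm (x b - y b)
      + (H * K + L\<^sup>2 + (\<Sum>i\<in>{1..m}. W i * (H * Ki i + L * Li i))) * M * ((b - a)\<^sup>2 / 4)
      + (\<Sum>i\<in>{1..m}. (H * Ki i + L * Li i) * (K + KV)
          * integral {a..b} (\<lambda>t. \<bar>v i t - w i t\<bar> * (\<bar>t - c\<bar> * \<bar>t - c\<bar>)))"
proof -
  let ?X = "\<lambda>t. f (x t) + (\<Sum>i\<in>{1..m}. v i t *\<^sub>R g i (x t))"
  let ?Y = "\<lambda>t. f (y t) + (\<Sum>i\<in>{1..m}. w i t *\<^sub>R g i (y t))"
  let ?JX = "\<lambda>t. (t - c) * (Jac f (x t) *v ?X t) $ k"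
  let ?JY = "\<lambda>t. (t - c) * (Jac f (y t) *v ?Y t) $ k"
  \<comment> \<open>\<open>?D\<close> compares both curves under the same control \<open>w\<close>,
    and \<open>?N\<close> carries the control difference along \<open>x\<close> only.\<close>
  let ?D = "\<lambda>t. (t - c) * ((Jac f (x t) *v f (x t)) $ k - (Jac f (y t) *v f (y t)) $ k)
      + (\<Sum>i\<in>{1..m}. w i t * ((t - c) * ((Jac f (x t) *v g i (x t)) $ k - (Jac f (y t) *v g i (y t)) $ k)))"
  let ?N = "\<lambda>i t. (v i t - w i t) * ((t - c) * (Jac f (x t) *v g i (x t)) $ k)"
  let ?C = "H * K + L\<^sup>2 + (\<Sum>i\<in>{1..m}. W i * (H * Ki i + L * Li i))"
  have fx: "(\<lambda>t. f (x t) $ k) integrable_on {a..b}"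
    by (intro integrable_continuous_real continuous_intros x_cont f_C2)
  have fy: "(\<lambda>t. f (y t) $ k) integrable_on {a..b}"
    by (intro integrable_continuous_real continuous_intros y_cont f_C2)
  have JX: "?JX integrable_on {a..b}"
    by (rule weighted_Df_field_integrable[OF x_sol xB v_le v_meas]) (auto intro!: continuous_intros)
  have JY: "?JY integrable_on {a..b}"
    by (rule weighted_Df_field_integrable[OF y_sol yB w_le w_meas]) (auto intro!: continuous_intros)
  have D: "?D integrable_on {a..b}"
    by (intro integrable_add integrable_sum w_integrable integrable_continuous_real continuous_on_mult
        continuous_on_diff continuous_on_id continuous_on_const Df_x_cont Df_y_cont f_C2 g_C2) auto
  have N: "?N i integrable_on {a..b}" if "i \<in> {1..m}" for i
    using that
    by (intro d_integrable continuous_on_mult continuous_on_diff continuous_on_id continuous_on_const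
        Df_x_cont g_C2)
  have "integral {a..b} (\<lambda>t. f (x t) $ k - f (y t) $ k)
      = integral {a..b} (\<lambda>t. f (x t) $ k) - integral {a..b} (\<lambda>t. f (y t) $ k)"
    by (intro integral_diff fx fy)
  also have "\<dots> = (b - c) * (f (x b) $ k - f (y b) $ k) - (integral {a..b} ?JX - integral {a..b} ?JY)"
  proof -
    \<comment> \<open>The boundary terms at \<open>a\<close> coincide because both curves start at
      \<open>x a\<close>; here they are the common summand \<open>r * Z\<close>.\<close>
    have "P - Q = p * (X - Y) - (I - J)" if "P = p * X - r * Z - I" "Q = p * Y - r * Z - J"
      for P Q p r X Y Z I J :: real
      using that by (simp add: algebra_simps)
    from this[OF integral_f_by_parts[OF x_sol xB v_le v_meas less_imp_le[OF ab]]
        integral_f_by_parts[OF y_sol yB w_le w_meas less_imp_le[OF ab], unfolded start]]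
    show ?thesis .
  qed
  also have "integral {a..b} ?JX - integral {a..b} ?JY = integral {a..b} (\<lambda>t. ?JX t - ?JY t)"
    by (intro integral_diff[symmetric] JX JY)
  also have "\<dots> = integral {a..b} (\<lambda>t. ?D t + (\<Sum>i\<in>{1..m}. ?N i t))"
  proof (rule integral_cong)
    fix t
    define \<sigma> where "\<sigma> = t - c"
    show "?JX t - ?JY t = ?D t + (\<Sum>i\<in>{1..m}. ?N i t)"
      unfolding \<sigma>_def[symmetric] matrix_vector_right_distrib linear_sum[OF matrix_vector_mul_linear]
        matrix_vector_mult_scaleR vector_add_component sum_component vector_scaleR_component
        distrib_left sum_distrib_left
      by (simp add: sum.distrib[symmetric] sum_subtractf[symmetric] algebra_simps)
  qed
  also have "\<dots> = integral {a..b} ?D + (\<Sum>i\<in>{1..m}. integral {a..b} (?N i))"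
    by (simp only: integral_add[OF D integrable_sum[OF finite_atLeastAtMost N]]
        integral_sum[OF finite_atLeastAtMost N])
  finally have eq: "integral {a..b} (\<lambda>t. f (x t) $ k - f (y t) $ k)
      = (b - c) * (f (x b) $ k - f (y b) $ k) - (integral {a..b} ?D + (\<Sum>i\<in>{1..m}. integral {a..b} (?N i)))" .
  have bm: "b \<in> {a..b}" using ab by simp
  have bc: "b - c = (b - a) / 2" by (simp add: field_simps)
  have "\<bar>f (x b) $ k - f (y b) $ k\<bar> \<le> L * mnorm (x b - y b)"
    using order_trans[OF component_le_mnorm f_lipschitz[OF xB[OF bm] yB[OF bm]], of k] by simp
  then have "(b - a) / 2 * \<bar>f (x b) $ k - f (y b) $ k\<bar> \<le> (b - a) / 2 * (L * mnorm (x b - y b))"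
    using ab by (intro mult_left_mono) auto
  also have "(b - a) / 2 * \<bar>f (x b) $ k - f (y b) $ k\<bar> = \<bar>(b - c) * (f (x b) $ k - f (y b) $ k)\<bar>"
    unfolding bc abs_mult using ab by simp
  finally have 1: "\<bar>(b - c) * (f (x b) $ k - f (y b) $ k)\<bar> \<le> L * ((b - a) / 2) * mnorm (x b - y b)"
    by (simp only: mult_ac)
  have "norm (integral {a..b} ?D) \<le> integral {a..b} (\<lambda>t. ?C * M * \<bar>t - c\<bar>)"
  proof (rule integral_norm_bound_integral[OF D])
    show "(\<lambda>t. ?C * M * \<bar>t - c\<bar>) integrable_on {a..b}"
      by (intro integrable_continuous_real continuous_intros)
    fix t assume t: "t \<in> {a..b}"
    let ?Af = "(Jac f (x t) *v f (x t)) $ k - (Jac f (y t) *v f (y t)) $ k"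
    let ?A = "\<lambda>i. (Jac f (x t) *v g i (x t)) $ k - (Jac f (y t) *v g i (y t)) $ k"
    have A0: "\<bar>?Af\<bar> \<le> (H * K + L\<^sup>2) * M"
      by (rule order_trans[OF Df_f_lipschitz[OF xB[OF t] yB[OF t]] mult_left_mono[OF M[OF t]]])
        (simp add: H_nonneg K_nonneg)
    have A: "\<bar>w i t * ?A i\<bar> \<le> W i * (H * Ki i + L * Li i) * M" if i: "i \<in> {1..m}" for i
    proof -
      have "\<bar>?A i\<bar> \<le> (H * Ki i + L * Li i) * M"
        by (rule order_trans[OF Df_g_lipschitz[OF i xB[OF t] yB[OF t]] mult_left_mono[OF M[OF t]]])
          (rule Df_g_constant_nonneg[OF i])
      then have "\<bar>w i t\<bar> * \<bar>?A i\<bar> \<le> W i * ((H * Ki i + L * Li i) * M)"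
        using w_le[OF i t] by (intro mult_mono) auto
      then show ?thesis by (simp add: abs_mult mult.assoc)
    qed
    have "\<bar>\<Sum>i\<in>{1..m}. w i t * ?A i\<bar> \<le> (\<Sum>i\<in>{1..m}. W i * (H * Ki i + L * Li i) * M)"
      by (rule order_trans[OF sum_abs sum_mono[OF A]])
    with A0 have "\<bar>?Af + (\<Sum>i\<in>{1..m}. w i t * ?A i)\<bar> \<le> ?C * M"
      by (simp add: distrib_right sum_distrib_right)
    then have "\<bar>t - c\<bar> * \<bar>?Af + (\<Sum>i\<in>{1..m}. w i t * ?A i)\<bar> \<le> \<bar>t - c\<bar> * (?C * M)"
      by (rule mult_left_mono) simp
    moreover have "?D t = (t - c) * (?Af + (\<Sum>i\<in>{1..m}. w i t * ?A i))"
      by (simp add: distrib_left sum_distrib_left mult.left_commute)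
    ultimately show "norm (?D t) \<le> ?C * M * \<bar>t - c\<bar>"
      by (simp only: abs_mult real_norm_def mult.commute)
  qed
  also have "\<dots> = ?C * M * ((b - a)\<^sup>2 / 4)"
    using integral_abs_centered[of a b] ab by simp
  finally have 2: "\<bar>integral {a..b} ?D\<bar> \<le> ?C * M * ((b - a)\<^sup>2 / 4)" by simp
  have 3: "\<bar>\<Sum>i\<in>{1..m}. integral {a..b} (?N i)\<bar> \<le> (\<Sum>i\<in>{1..m}. (H * Ki i + L * Li i) * (K + KV)
          * integral {a..b} (\<lambda>t. \<bar>v i t - w i t\<bar> * (\<bar>t - c\<bar> * \<bar>t - c\<bar>)))"
  proof (rule order_trans[OF sum_abs sum_mono])
    fix i assume i: "i \<in> {1..m}"
    show "\<bar>integral {a..b} (?N i)\<bar> \<le> (H * Ki i + L * Li i) * (K + KV)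
          * integral {a..b} (\<lambda>t. \<bar>v i t - w i t\<bar> * (\<bar>t - c\<bar> * \<bar>t - c\<bar>))"
    proof (rule abs_integral_centered_le[OF d_meas[OF i] d_le[OF i]])
      show "continuous_on {a..b} (\<lambda>t. t - c)" by (intro continuous_intros)
      show "continuous_on {a..b} (\<lambda>t. (Jac f (x t) *v g i (x t)) $ k)"
        by (intro Df_x_cont g_C2 i)
      show "integral {a..b} (\<lambda>t. (v i t - w i t) * (t - c)) = 0"
        using mom1[OF i] by (simp add: mult.commute)
      fix t assume t: "t \<in> {a..b}"
      have "\<bar>(Jac f (x t) *v g i (x t)) $ k - (Jac f (x c) *v g i (x c)) $ k\<bar>
          \<le> (H * Ki i + L * Li i) * mnorm (x t - x c)"
        by (rule Df_g_lipschitz[OF i xB[OF t] xB[OF c_mem]])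
      also have "\<dots> \<le> (H * Ki i + L * Li i) * ((K + KV) * \<bar>t - c\<bar>)"
        by (intro mult_left_mono x_lip t c_mem Df_g_constant_nonneg i)
      finally show "\<bar>(Jac f (x t) *v g i (x t)) $ k - (Jac f (x c) *v g i (x c)) $ k\<bar>
          \<le> (H * Ki i + L * Li i) * (K + KV) * \<bar>t - c\<bar>"
        by (simp add: mult.assoc)
    qed
  qed
  show ?thesis unfolding eq using 1 2 3 by linarith
qed

end

subsection \<open>Affine controls\<close>

locale affine_matched_controls = bounded_system f g m B K L H \<Lambda> Ki Li
  for f :: "real^'n \<Rightarrow> real^'n" and g m B K L H \<Lambda> Ki Li +
  fixes a b :: real and x y :: "real \<Rightarrow> real^'n" and v w :: "nat \<Rightarrow> real \<Rightarrow> real" and V :: "nat \<Rightarrow> real"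
  assumes ab: "a < b" and \<Lambda>: "\<Lambda> \<noteq> 0"
    and v_meas: "\<And>i. i \<in> {1..m} \<Longrightarrow> v i \<in> borel_measurable (lebesgue_on {a..b})"
    and v_le: "\<And>i t. i \<in> {1..m} \<Longrightarrow> t \<in> {a..b} \<Longrightarrow> \<bar>v i t\<bar> \<le> V i"
    and V_pos: "\<And>i. i \<in> {1..m} \<Longrightarrow> 0 < V i"
    and w_affine: "\<And>i. i \<in> {1..m} \<Longrightarrow> \<exists>p q. \<forall>t\<in>{a..b}. w i t = p + q * t"
    and x_sol: "is_sol f g m v a b x" and y_sol: "is_sol f g m w a b y" and start: "y a = x a"
    and xB: "\<And>t. t \<in> {a..b} \<Longrightarrow> x t \<in> B" and yB: "\<And>t. t \<in> {a..b} \<Longrightarrow> y t \<in> B"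
    and mom0: "\<And>i. i \<in> {1..m} \<Longrightarrow> integral {a..b} (\<lambda>t. v i t - w i t) = 0"
    and mom1: "\<And>i. i \<in> {1..m} \<Longrightarrow> integral {a..b} (\<lambda>t. (t - (a + b) / 2) * (v i t - w i t)) = 0"
begin

lemma w_L2: "i \<in> {1..m} \<Longrightarrow> integral {a..b} (\<lambda>t. (w i t)\<^sup>2) \<le> (V i)\<^sup>2 * (b - a)"
  and d_L2: "i \<in> {1..m} \<Longrightarrow> integral {a..b} (\<lambda>t. (v i t - w i t)\<^sup>2) \<le> (V i)\<^sup>2 * (b - a)"
  and w_sup: "i \<in> {1..m} \<Longrightarrow> t \<in> {a..b} \<Longrightarrow> \<bar>w i t\<bar> \<le> 2 * V i"
proof -
  assume i: "i \<in> {1..m}"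
  obtain p q where "\<And>t. t \<in> {a..b} \<Longrightarrow> w i t = p + q * t"
    using w_affine[OF i] by blast
  note proj = affine_projection[OF ab v_meas[OF i] v_le[OF i] this mom0[OF i] mom1[OF i]]
  show "integral {a..b} (\<lambda>t. (w i t)\<^sup>2) \<le> (V i)\<^sup>2 * (b - a)"
    "integral {a..b} (\<lambda>t. (v i t - w i t)\<^sup>2) \<le> (V i)\<^sup>2 * (b - a)"
    by (rule proj; assumption)+
  show "\<bar>w i t\<bar> \<le> 2 * V i" if "t \<in> {a..b}"
    by (rule proj(3)[OF _ _ that])
qed

lemma w_meas:
  assumes i: "i \<in> {1..m}"
  shows "w i \<in> borel_measurable (lebesgue_on {a..b})"
proof -
  obtain p q where "\<And>t. t \<in> {a..b} \<Longrightarrow> w i t = p + q * t"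
    using w_affine[OF i] by blast
  then have "continuous_on {a..b} (w i)"
    by (subst continuous_on_cong[OF refl, of _ _ "\<lambda>t. p + q * t"]) (auto intro!: continuous_intros)
  then show ?thesis
    by (rule continuous_imp_measurable_on_sets_lebesgue) auto
qed

text \<open>The projection gives the supremum bound \<open>2 * V i\<close>; it is relaxed to the
  factor 5/2 that occurs in the claimed estimate, so that \<open>KV + KW\<close> becomes
  \<open>7 / 2 * KV\<close>.\<close>

sublocale matched_controls f g m B K L H \<Lambda> Ki Li a b x y v w V "\<lambda>i. 5 / 2 * V i"
proof
  fix i t assume it: "i \<in> {1..m}" "t \<in> {a..b}"
  show "\<bar>w i t\<bar> \<le> 5 / 2 * V i"
    using w_sup[OF it] V_pos[OF it(1)] by linarith
qed (fact ab v_meas v_le w_meas x_sol y_sol start xB yB mom0 | assumption)+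

lemma KW_eq: "KW = 5 / 2 * KV"
  unfolding KW_def KV_def sum_distrib_left mult.assoc by (rule refl)

text \<open>The weights \<open>2/h\<close>, \<open>4/h\<close>, \<open>9/h\<^sup>2\<close> are roughly the minimisers of the AM-GM bound in \<open>\<kappa>\<close>. The
  pointwise bound on \<open>d\<^sub>i\<close> would not suffice for the constant \<open>7/48\<close>.\<close>

lemma weighted_L1_bounds:
  assumes i: "i \<in> {1..m}"
  shows "integral {a..b} (\<lambda>t. \<bar>w i t\<bar> * (t - a)) \<le> 7 / 12 * V i * (b - a)\<^sup>2"
    and "integral {a..b} (\<lambda>t. \<bar>v i t - w i t\<bar> * \<bar>t - c\<bar>) \<le> 7 / 24 * V i * (b - a)\<^sup>2"
    and "integral {a..b} (\<lambda>t. \<bar>v i t - w i t\<bar> * (\<bar>t - c\<bar> * \<bar>t - c\<bar>)) \<le> 7 / 48 * V i * (b - a) ^ 3"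
proof -
  define h where "h = b - a"
  have h: "0 < h" using ab by (simp add: h_def)
  have bc: "b - c = h / 2" "a - c = - (h / 2)" by (simp_all add: h_def field_simps)
  have "integral {a..b} (\<lambda>t. (t - a)\<^sup>2) = h ^ 3 / 3"
    using has_integral_shifted_power[of a b a 2] ab by (simp add: h_def integral_unique power3_eq_cube numeral_3_eq_3 power2_eq_square)
  from integral_weighted_le_L2[OF ab w_meas[OF i] w_sup[OF i] _ _ this V_pos[OF i] w_L2[OF i], of "2 / h"]
  have "integral {a..b} (\<lambda>t. \<bar>w i t\<bar> * (t - a)) \<le> V i * (2 / h * (h ^ 3 / 3) + h / (2 / h)) / 2"
    using h by (simp add: h_def continuous_intros)
  also have "\<dots> = 7 / 12 * V i * h\<^sup>2"
    using h by (simp add: field_simps power2_eq_square power3_eq_cube)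
  finally show "integral {a..b} (\<lambda>t. \<bar>w i t\<bar> * (t - a)) \<le> 7 / 12 * V i * (b - a)\<^sup>2"
    by (simp add: h_def)
  have "integral {a..b} (\<lambda>t. \<bar>t - c\<bar>\<^sup>2) = ((b - c) ^ 3 - (a - c) ^ 3) / 3"
    using has_integral_shifted_power[of a b c 2] ab by (simp add: integral_unique numeral_3_eq_3)
  also have "\<dots> = h ^ 3 / 12"
    unfolding bc by (simp add: field_simps)
  finally have "integral {a..b} (\<lambda>t. \<bar>t - c\<bar>\<^sup>2) = h ^ 3 / 12" .
  from integral_weighted_le_L2[OF ab d_meas[OF i] d_le[OF i] _ _ this V_pos[OF i] d_L2[OF i], of "4 / h"]
  have "integral {a..b} (\<lambda>t. \<bar>v i t - w i t\<bar> * \<bar>t - c\<bar>) \<le> V i * (4 / h * (h ^ 3 / 12) + h / (4 / h)) / 2"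
    using h by (simp add: h_def continuous_intros)
  also have "\<dots> = 7 / 24 * V i * h\<^sup>2"
    using h by (simp add: field_simps power2_eq_square power3_eq_cube)
  finally show "integral {a..b} (\<lambda>t. \<bar>v i t - w i t\<bar> * \<bar>t - c\<bar>) \<le> 7 / 24 * V i * (b - a)\<^sup>2"
    by (simp add: h_def)
  have sq: "(\<bar>t - c\<bar> * \<bar>t - c\<bar>)\<^sup>2 = (t - c) ^ 4" for t
    by (simp add: power2_eq_square power4_eq_xxxx)
  have "integral {a..b} (\<lambda>t. (\<bar>t - c\<bar> * \<bar>t - c\<bar>)\<^sup>2) = ((b - c) ^ Suc 4 - (a - c) ^ Suc 4) / 5"
    unfolding sq using has_integral_shifted_power[of a b c 4] ab by (simp add: integral_unique)
  also have "\<dots> = h ^ 5 / 80"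
    unfolding bc by (simp add: field_simps)
  finally have "integral {a..b} (\<lambda>t. (\<bar>t - c\<bar> * \<bar>t - c\<bar>)\<^sup>2) = h ^ 5 / 80" .
  from integral_weighted_le_L2[OF ab d_meas[OF i] d_le[OF i] _ _ this V_pos[OF i] d_L2[OF i], of "9 / h\<^sup>2"]
  have "integral {a..b} (\<lambda>t. \<bar>v i t - w i t\<bar> * (\<bar>t - c\<bar> * \<bar>t - c\<bar>))
      \<le> V i * (9 / h\<^sup>2 * (h ^ 5 / 80) + h / (9 / h\<^sup>2)) / 2"
    using h by (simp add: h_def continuous_intros)
  also have "\<dots> = 161 / 1440 * V i * h ^ 3"
    using h by (simp add: field_simps eval_nat_numeral)
  \<comment> \<open>The constant of the claim is 7/48 = 210/1440.\<close>
  also have "\<dots> \<le> 7 / 48 * V i * h ^ 3"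
    using h V_pos[OF i] by (intro mult_right_mono) auto
  finally show "integral {a..b} (\<lambda>t. \<bar>v i t - w i t\<bar> * (\<bar>t - c\<bar> * \<bar>t - c\<bar>)) \<le> 7 / 48 * V i * (b - a) ^ 3"
    by (simp add: h_def)
qed

text \<open>The constant \<open>L'\<close> of the theorem.\<close>

definition "LV = (\<Sum>i\<in>{1..m}. V i * Li i)"

lemma LV_nonneg: "0 \<le> LV"
  unfolding LV_def using V_nonneg Li_nonneg by (auto intro!: sum_nonneg)

text \<open>The drift and control estimates are added with all integrals evaluated, and the boundary
  term, a multiple of the final error, is moved to the left. The coefficient 7/8 is the 7/2 of the
  Gronwall bound times the 1/4 from the integral of |t - c|.\<close>

lemma affine_local_error:
  defines "h \<equiv> b - a"
  shows "(1 - L * h / 2) * mnorm (x b - y b)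
    \<le> h\<^sup>2 / 4 * LV * (35 / 6 * K + 28 / 3 * KV)
      + 7 * h ^ 3 / 8 * KV * (H * (K + 5 / 2 * KV) + L\<^sup>2 + 5 / 2 * L * LV) * ((exp (\<Lambda> * h) - 1) / (\<Lambda> * h))
      + 7 * h ^ 3 / 48 * (H * KV + L * LV) * (K + KV)"
proof -
  define E where "E = (exp (\<Lambda> * h) - 1) / (\<Lambda> * h)"
  have h: "0 < h" using ab by (simp add: h_def)
  \<comment> \<open>The Gronwall bound at the right endpoint: \<open>h * E\<close> is
    \<open>(exp (\<Lambda> * h) - 1) / \<Lambda>\<close>, and monotonicity makes it valid on the
    whole step.\<close>
  define M where "M = 7 / 2 * KV * (h * E)"
  have M: "mnorm (x t - y t) \<le> M" if t: "t \<in> {a..b}" for t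
  proof -
    have "mnorm (x t - y t) \<le> 7 / 2 * KV * ((exp (\<Lambda> * (t - a)) - 1) / \<Lambda>)"
      using error_gronwall[OF \<Lambda> t] unfolding KW_eq by simp
    also have "\<dots> \<le> 7 / 2 * KV * ((exp (\<Lambda> * h) - 1) / \<Lambda>)"
      using t KV_nonneg by (intro mult_left_mono expm1_over_mono \<Lambda>) (auto simp: h_def)
    also have "\<dots> = M"
      using h by (simp add: M_def E_def)
    finally show ?thesis .
  qed
  have HLsum: "(\<Sum>i\<in>{1..m}. V i * (H * Ki i + L * Li i)) = H * KV + L * LV"
    by (simp add: KV_def LV_def sum_distrib_left sum.distrib algebra_simps)
  have "mnorm (x b - y b) \<le> L * (h / 2) * mnorm (x b - y b)
      + (H * K + L\<^sup>2 + 5 / 2 * (H * KV + L * LV)) * M * (h\<^sup>2 / 4)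
      + 7 / 48 * h ^ 3 * (K + KV) * (H * KV + L * LV)
      + h\<^sup>2 * (35 / 24 * K + 56 / 24 * KV) * LV"
  proof (rule mnorm_leI)
    fix k
    have "(\<Sum>i\<in>{1..m}. (H * Ki i + L * Li i) * (K + KV)
          * integral {a..b} (\<lambda>t. \<bar>v i t - w i t\<bar> * (\<bar>t - c\<bar> * \<bar>t - c\<bar>)))
        \<le> (\<Sum>i\<in>{1..m}. 7 / 48 * h ^ 3 * (K + KV) * (V i * (H * Ki i + L * Li i)))"
    proof (rule sum_mono)
      fix i assume i: "i \<in> {1..m}"
      have "(H * Ki i + L * Li i) * (K + KV) * integral {a..b} (\<lambda>t. \<bar>v i t - w i t\<bar> * (\<bar>t - c\<bar> * \<bar>t - c\<bar>))
          \<le> (H * Ki i + L * Li i) * (K + KV) * (7 / 48 * V i * h ^ 3)"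
        unfolding h_def
        by (intro mult_left_mono weighted_L1_bounds i)
          (intro mult_nonneg_nonneg add_nonneg_nonneg[OF K_nonneg KV_nonneg] Df_g_constant_nonneg i)
      then show "(H * Ki i + L * Li i) * (K + KV) * integral {a..b} (\<lambda>t. \<bar>v i t - w i t\<bar> * (\<bar>t - c\<bar> * \<bar>t - c\<bar>))
          \<le> 7 / 48 * h ^ 3 * (K + KV) * (V i * (H * Ki i + L * Li i))"
        by (simp only: mult_ac)
    qed
    also have "\<dots> = 7 / 48 * h ^ 3 * (K + KV) * (H * KV + L * LV)"
      by (simp only: sum_distrib_left[symmetric] HLsum)
    finally have 1: "(\<Sum>i\<in>{1..m}. (H * Ki i + L * Li i) * (K + KV)
          * integral {a..b} (\<lambda>t. \<bar>v i t - w i t\<bar> * (\<bar>t - c\<bar> * \<bar>t - c\<bar>)))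
        \<le> 7 / 48 * h ^ 3 * (K + KV) * (H * KV + L * LV)" .
    have W: "(\<Sum>i\<in>{1..m}. 5 / 2 * V i * (H * Ki i + L * Li i)) = 5 / 2 * (H * KV + L * LV)"
      by (simp only: HLsum[symmetric] sum_distrib_left mult.assoc)
    have 2: "\<bar>integral {a..b} (\<lambda>t. f (x t) $ k - f (y t) $ k)\<bar> \<le> L * (h / 2) * mnorm (x b - y b)
      + (H * K + L\<^sup>2 + 5 / 2 * (H * KV + L * LV)) * M * (h\<^sup>2 / 4)
      + 7 / 48 * h ^ 3 * (K + KV) * (H * KV + L * LV)"
      using drift_error_le[OF mom1 M, of k] 1 unfolding W h_def[symmetric] by linarith
    have "\<bar>\<Sum>i\<in>{1..m}. integral {a..b} (\<lambda>t. (v i t - w i t) * g i (x t) $ k)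
        + integral {a..b} (\<lambda>t. w i t * (g i (x t) $ k - g i (y t) $ k))\<bar>
      \<le> (\<Sum>i\<in>{1..m}. h\<^sup>2 * (35 / 24 * K + 56 / 24 * KV) * (V i * Li i))"
    proof (rule order_trans[OF sum_abs sum_mono], rule order_trans[OF control_error_le])
      fix i assume i: "i \<in> {1..m}"
      show "i \<in> {1..m}" by fact
      have "Li i * ((K + KV) * integral {a..b} (\<lambda>t. \<bar>v i t - w i t\<bar> * \<bar>t - c\<bar>)
          + (2 * K + KV + KW) * integral {a..b} (\<lambda>t. \<bar>w i t\<bar> * (t - a)))
        \<le> Li i * ((K + KV) * (7 / 24 * V i * h\<^sup>2) + (2 * K + KV + KW) * (7 / 12 * V i * h\<^sup>2))"
        unfolding h_def KW_eq
        by (intro mult_left_mono add_mono weighted_L1_bounds i Li_nonneg)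
          (simp_all add: K_nonneg KV_nonneg)
      \<comment> \<open>The coefficient of \<open>K\<close> is 7/24 + 2 * 7/12 = 35/24, and that of
        \<open>KV\<close> is 7/24 + 7/2 * 7/12 = 56/24.\<close>
      also have "\<dots> = h\<^sup>2 * (35 / 24 * K + 56 / 24 * KV) * (V i * Li i)"
        unfolding KW_eq by (simp add: field_simps)
      finally show "Li i * ((K + KV) * integral {a..b} (\<lambda>t. \<bar>v i t - w i t\<bar> * \<bar>t - c\<bar>)
          + (2 * K + KV + KW) * integral {a..b} (\<lambda>t. \<bar>w i t\<bar> * (t - a)))
        \<le> h\<^sup>2 * (35 / 24 * K + 56 / 24 * KV) * (V i * Li i)" .
    qed
    also have "\<dots> = h\<^sup>2 * (35 / 24 * K + 56 / 24 * KV) * LV"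
      by (simp only: LV_def sum_distrib_left)
    finally show "\<bar>(x b - y b) $ k\<bar> \<le> L * (h / 2) * mnorm (x b - y b)
      + (H * K + L\<^sup>2 + 5 / 2 * (H * KV + L * LV)) * M * (h\<^sup>2 / 4)
      + 7 / 48 * h ^ 3 * (K + KV) * (H * KV + L * LV)
      + h\<^sup>2 * (35 / 24 * K + 56 / 24 * KV) * LV"
      unfolding error_component using 2 by linarith
  qed
  then show ?thesis
    unfolding E_def[symmetric] M_def
    by (simp add: field_simps power2_eq_square power3_eq_cube)
qed

end

section \<open>Quadratic local error, and the explicit estimate for affine controls\<close>

theorem mainTheorem8:
  fixes f :: "real^'n \<Rightarrow> real^'n" and g :: "nat \<Rightarrow> real^'n \<Rightarrow> real^'n" and m :: nat
    and V Ki Li Hi W :: "nat \<Rightarrow> real" and K L H \<Lambda> :: real and B :: "(real^'n) set"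
  assumes m: "m \<ge> 1"
    and V: "\<And>i. i \<in> {1..m} \<Longrightarrow> V i > 0"
    and f_C2: "C2 f"
    and g_C2: "\<And>i. i \<in> {1..m} \<Longrightarrow> C2 (g i)"
    and g_nonconst: "\<And>i. i \<in> {1..m} \<Longrightarrow> \<not> (\<exists>c. \<forall>z. g i z = c)"
    and B: "convex B"
    and bK: "\<And>z. z \<in> B \<Longrightarrow> mnorm (f z) \<le> K"
    and bKi: "\<And>i z. i \<in> {1..m} \<Longrightarrow> z \<in> B \<Longrightarrow> mnorm (g i z) \<le> Ki i"
    and bL: "\<And>z. z \<in> B \<Longrightarrow> mat_norm (Jac f z) \<le> L"
    and bLi: "\<And>i z. i \<in> {1..m} \<Longrightarrow> z \<in> B \<Longrightarrow> mat_norm (Jac (g i) z) \<le> Li i"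
    and bH: "\<And>z. z \<in> B \<Longrightarrow> d2_norm f z \<le> H"
    and bHi: "\<And>i z. i \<in> {1..m} \<Longrightarrow> z \<in> B \<Longrightarrow> d2_norm (g i) z \<le> Hi i"
    and bLam: "\<And>z. z \<in> B \<Longrightarrow> log_norm (Jac f z) \<le> \<Lambda>"
    and Lam: "\<Lambda> \<noteq> 0"
  defines "K' \<equiv> (\<Sum>i\<in>{1..m}. V i * Ki i)"
    and "L' \<equiv> (\<Sum>i\<in>{1..m}. V i * Li i)"
    and "H' \<equiv> (\<Sum>i\<in>{1..m}. V i * Hi i)"
  shows
    "(\<exists>C. \<forall>tk tk1 x v w y.
        tk < tk1
        \<and> (\<forall>i\<in>{1..m}. v i \<in> borel_measurable lebesgue \<and> (\<forall>t. \<bar>v i t\<bar> \<le> V i))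
        \<and> (\<forall>i\<in>{1..m}. w i \<in> borel_measurable (lebesgue_on {tk..tk1})
               \<and> (\<forall>t\<in>{tk..tk1}. \<bar>w i t\<bar> \<le> W i))
        \<and> is_sol f g m v tk tk1 x \<and> is_sol f g m w tk tk1 y \<and> y tk = x tk
        \<and> (\<forall>t\<in>{tk..tk1}. x t \<in> B \<and> y t \<in> B)
        \<and> (\<forall>i\<in>{1..m}. integral {tk..tk1} (\<lambda>t. v i t - w i t) = 0
               \<and> integral {tk..tk1} (\<lambda>t. (t - (tk + tk1) / 2) * (v i t - w i t)) = 0)
        \<longrightarrow> mnorm (x tk1 - y tk1) \<le> C * (tk1 - tk)\<^sup>2)
     \<and> (\<forall>tk tk1 x v w y.
        tk < tk1
        \<and> (\<forall>i\<in>{1..m}. v i \<in> borel_measurable lebesgue \<and> (\<forall>t. \<bar>v i t\<bar> \<le> V i))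
        \<and> (\<forall>i\<in>{1..m}. \<exists>a b. \<forall>t\<in>{tk..tk1}. w i t = a + b * t)
        \<and> is_sol f g m v tk tk1 x \<and> is_sol f g m w tk tk1 y \<and> y tk = x tk
        \<and> (\<forall>t\<in>{tk..tk1}. x t \<in> B \<and> y t \<in> B)
        \<and> (\<forall>i\<in>{1..m}. integral {tk..tk1} (\<lambda>t. v i t - w i t) = 0
               \<and> integral {tk..tk1} (\<lambda>t. (t - (tk + tk1) / 2) * (v i t - w i t)) = 0)
        \<longrightarrow> (let h = tk1 - tk; E = (exp (\<Lambda> * h) - 1) / (\<Lambda> * h) in
             (1 - L * h / 2 - h * L') * mnorm (x tk1 - y tk1)
             \<le> h\<^sup>2 / 4 * L' * (11 * K + 69 / 2 * K')
              + 7 * h ^ 3 / 8 * K' * ((4 * H' + H) * (K + 5 / 2 * K') + L\<^sup>2 + (9 / 2 * L + 5 * L') * L') * E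
              + 7 * h ^ 3 / 48 * (H * K' + L * L') * (K + K')))"
proof (intro conjI)
  show "\<exists>C. \<forall>tk tk1 x v w y.
        tk < tk1
        \<and> (\<forall>i\<in>{1..m}. v i \<in> borel_measurable lebesgue \<and> (\<forall>t. \<bar>v i t\<bar> \<le> V i))
        \<and> (\<forall>i\<in>{1..m}. w i \<in> borel_measurable (lebesgue_on {tk..tk1})
               \<and> (\<forall>t\<in>{tk..tk1}. \<bar>w i t\<bar> \<le> W i))
        \<and> is_sol f g m v tk tk1 x \<and> is_sol f g m w tk tk1 y \<and> y tk = x tk
        \<and> (\<forall>t\<in>{tk..tk1}. x t \<in> B \<and> y t \<in> B)
        \<and> (\<forall>i\<in>{1..m}. integral {tk..tk1} (\<lambda>t. v i t - w i t) = 0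
               \<and> integral {tk..tk1} (\<lambda>t. (t - (tk + tk1) / 2) * (v i t - w i t)) = 0)
        \<longrightarrow> mnorm (x tk1 - y tk1) \<le> C * (tk1 - tk)\<^sup>2"
  proof (intro exI allI impI)
    fix a b :: real and x y :: "real \<Rightarrow> real^'n" and v w :: "nat \<Rightarrow> real \<Rightarrow> real"
    assume *: "a < b
        \<and> (\<forall>i\<in>{1..m}. v i \<in> borel_measurable lebesgue \<and> (\<forall>t. \<bar>v i t\<bar> \<le> V i))
        \<and> (\<forall>i\<in>{1..m}. w i \<in> borel_measurable (lebesgue_on {a..b})
               \<and> (\<forall>t\<in>{a..b}. \<bar>w i t\<bar> \<le> W i))
        \<and> is_sol f g m v a b x \<and> is_sol f g m w a b y \<and> y a = x a
        \<and> (\<forall>t\<in>{a..b}. x t \<in> B \<and> y t \<in> B)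
        \<and> (\<forall>i\<in>{1..m}. integral {a..b} (\<lambda>t. v i t - w i t) = 0
               \<and> integral {a..b} (\<lambda>t. (t - (a + b) / 2) * (v i t - w i t)) = 0)"
    then have "x a \<in> B" by simp
    interpret matched_controls f g m B K L H \<Lambda> Ki Li a b x y v w V W
    proof
      show "v i \<in> borel_measurable (lebesgue_on {a..b})" if "i \<in> {1..m}" for i
        using * that by (blast intro: measurable_restrict_space1)
    qed (use * \<open>x a \<in> B\<close> f_C2 g_C2 B bK bKi bL bLi bH bLam in blast)+
    \<comment> \<open>This instantiates the constant \<open>C\<close>, which was left open; it
      mentions none of the variables fixed after it.\<close>
    show "mnorm (x b - y b) \<le> (L * (2 * K + K' + (\<Sum>i\<in>{1..m}. W i * Ki i))
      + (\<Sum>i\<in>{1..m}. Li i * ((K + K') * (V i + W i) + (2 * K + K' + (\<Sum>i\<in>{1..m}. W i * Ki i)) * W i))) * (b - a)\<^sup>2"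
      using local_error_quadratic unfolding KV_def KW_def K'_def .
  qed
next
  show "\<forall>tk tk1 x v w y.
        tk < tk1
        \<and> (\<forall>i\<in>{1..m}. v i \<in> borel_measurable lebesgue \<and> (\<forall>t. \<bar>v i t\<bar> \<le> V i))
        \<and> (\<forall>i\<in>{1..m}. \<exists>a b. \<forall>t\<in>{tk..tk1}. w i t = a + b * t)
        \<and> is_sol f g m v tk tk1 x \<and> is_sol f g m w tk tk1 y \<and> y tk = x tk
        \<and> (\<forall>t\<in>{tk..tk1}. x t \<in> B \<and> y t \<in> B)
        \<and> (\<forall>i\<in>{1..m}. integral {tk..tk1} (\<lambda>t. v i t - w i t) = 0
               \<and> integral {tk..tk1} (\<lambda>t. (t - (tk + tk1) / 2) * (v i t - w i t)) = 0)
        \<longrightarrow> (let h = tk1 - tk; E = (exp (\<Lambda> * h) - 1) / (\<Lambda> * h) in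
             (1 - L * h / 2 - h * L') * mnorm (x tk1 - y tk1)
             \<le> h\<^sup>2 / 4 * L' * (11 * K + 69 / 2 * K')
              + 7 * h ^ 3 / 8 * K' * ((4 * H' + H) * (K + 5 / 2 * K') + L\<^sup>2 + (9 / 2 * L + 5 * L') * L') * E
              + 7 * h ^ 3 / 48 * (H * K' + L * L') * (K + K'))"
  proof (intro allI impI)
    fix a b :: real and x y :: "real \<Rightarrow> real^'n" and v w :: "nat \<Rightarrow> real \<Rightarrow> real"
    assume *: "a < b
        \<and> (\<forall>i\<in>{1..m}. v i \<in> borel_measurable lebesgue \<and> (\<forall>t. \<bar>v i t\<bar> \<le> V i))
        \<and> (\<forall>i\<in>{1..m}. \<exists>p q. \<forall>t\<in>{a..b}. w i t = p + q * t)
        \<and> is_sol f g m v a b x \<and> is_sol f g m w a b y \<and> y a = x a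
        \<and> (\<forall>t\<in>{a..b}. x t \<in> B \<and> y t \<in> B)
        \<and> (\<forall>i\<in>{1..m}. integral {a..b} (\<lambda>t. v i t - w i t) = 0
               \<and> integral {a..b} (\<lambda>t. (t - (a + b) / 2) * (v i t - w i t)) = 0)"
    then have xa: "x a \<in> B" by simp
    interpret affine_matched_controls f g m B K L H \<Lambda> Ki Li a b x y v w V
    proof
      show "v i \<in> borel_measurable (lebesgue_on {a..b})" if "i \<in> {1..m}" for i
        using * that by (blast intro: measurable_restrict_space1)
    qed (use * xa f_C2 g_C2 B bK bKi bL bLi bH bLam Lam V in blast)+
    define h where "h = b - a"
    define E where "E = (exp (\<Lambda> * h) - 1) / (\<Lambda> * h)"
    have h: "0 < h" using ab by (simp add: h_def)
    have eq: "K' = KV" "L' = LV"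
      by (simp_all add: K'_def L'_def KV_def LV_def)
    \<comment> \<open>Comparison with the value 0 of the quotient at length 0 gives the sign of
      \<open>E\<close> without distinguishing the sign of \<Lambda>.\<close>
    have "0 \<le> (exp (\<Lambda> * h) - 1) / \<Lambda>"
      using expm1_over_mono[OF \<Lambda>, of 0 h] h by simp
    then have "0 \<le> (exp (\<Lambda> * h) - 1) / \<Lambda> / h"
      using h by (rule divide_nonneg_pos)
    then have E: "0 \<le> E"
      by (simp only: E_def divide_divide_eq_left)
    have H': "0 \<le> H'"
      unfolding H'_def
    proof (intro sum_nonneg mult_nonneg_nonneg)
      fix i assume i: "i \<in> {1..m}"
      show "0 \<le> V i" using V[OF i] by simp
      show "0 \<le> Hi i"
        using bHi[OF i xa] d2_norm_nonneg[of "g i" "x a"] g_C2[OF i] unfolding C2_def by force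
    qed
    \<comment> \<open>Subtracting the non-negative \<open>h * LV\<close> from the factor can only
      lower the left-hand side.\<close>
    have "(1 - L * h / 2 - h * LV) * mnorm (x b - y b) \<le> (1 - L * h / 2) * mnorm (x b - y b)"
      using h LV_nonneg by (intro mult_right_mono mnorm_nonneg) simp
    also have "\<dots> \<le> h\<^sup>2 / 4 * LV * (35 / 6 * K + 28 / 3 * KV)
      + 7 * h ^ 3 / 8 * KV * (H * (K + 5 / 2 * KV) + L\<^sup>2 + 5 / 2 * L * LV) * E
      + 7 * h ^ 3 / 48 * (H * KV + L * LV) * (K + KV)"
      unfolding E_def h_def by (rule affine_local_error)
    \<comment> \<open>Termwise enlargement to the stated constants: 35/6 \<le> 11, 28/3 \<le> 69/2
      and 5/2 \<le> 9/2, while \<open>4 * H'\<close> and the square term in \<open>LV\<close> are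
      non-negative additions.\<close>
    also have "\<dots> \<le> h\<^sup>2 / 4 * LV * (11 * K + 69 / 2 * KV)
      + 7 * h ^ 3 / 8 * KV * ((4 * H' + H) * (K + 5 / 2 * KV) + L\<^sup>2 + (9 / 2 * L + 5 * LV) * LV) * E
      + 7 * h ^ 3 / 48 * (H * KV + L * LV) * (K + KV)"
      by (intro add_mono order_refl mult_left_mono mult_right_mono E)
        (use h K_nonneg L_nonneg KV_nonneg LV_nonneg H' in auto)
    finally show "let h = b - a; E = (exp (\<Lambda> * h) - 1) / (\<Lambda> * h) in
             (1 - L * h / 2 - h * L') * mnorm (x b - y b)
             \<le> h\<^sup>2 / 4 * L' * (11 * K + 69 / 2 * K')
              + 7 * h ^ 3 / 8 * K' * ((4 * H' + H) * (K + 5 / 2 * K') + L\<^sup>2 + (9 / 2 * L + 5 * L') * L') * E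
              + 7 * h ^ 3 / 48 * (H * K' + L * L') * (K + K')"
      unfolding Let_def eq E_def h_def .
  qed
qed

end
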